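(* Let $n\ge3$ and let $g$ be a $C^2$ Riemannian metric defined near infinity of $\mathbb R^n$, written in the standard coordinates as $g=g_{ij}dx^idx^j$, with $g_{ij}-\delta_{ij}=o_2(|x|^{-\frac{n-2}{2}})$, and satisfying the Regge–Teitelboim condition $g_{ij}^{\mathrm{odd}}(x)=o_2(|x|^{-\frac n2})$ for all $i,j$. Assume the ADM mass $\mathfrak m$ exists and $\mathfrak m\neq 0$. Then $\lim_{r\to\infty}\big(\mathbf c_{CS}(r)-\mathbf c_I(r)\big)=0$.
   Context: Summation over repeated indices is used; commas denote partial derivatives in the coordinates $x^i$. $B(r)=\{|x|<r\}$, $S_r=\partial B(r)$. $f=o_k(|x|^{-\tau})$ means $f\in C^k$ and $|x|^{|\alpha|+\tau}|\partial^\alpha f(x)|\to0$ as $x\to\infty$ for all $|\alpha|\le k$. $f^{\mathrm{odd}}(x)=\tfrac12(f(x)-f(-x))$. On $S_r$, $\nu_e,d\sigma_e$ are the Euclidean unit outward normal and area element, $\nu_g,d\sigma_g$ those for $g$; $\omega_{n-1}$ is the area of the unit sphere in $\mathbb R^n$; $\mathrm{Ric},R_g$ are the Ricci and scalar curvature of $g$. The ADM mass is $\mathfrak m=\lim_{r\to\infty}\frac{1}{2(n-1)\omega_{n-1}}\int_{S_r}(g_{ij,j}-g_{jj,i})\nu_e^i\,d\sigma_e$. For $\alpha=1,\dots,n$: $c^\alpha_{CS}(r)=\frac{1}{2(n-1)\omega_{n-1}\mathfrak m}\int_{S_r}\big[x^\alpha(g_{ij,i}-g_{ii,j})\nu_e^j-(g_{i\alpha}\nu_e^i-g_{ii}\nu_e^\alpha)\big]d\sigma_e$,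 $c^\alpha_I(r)=\frac{1}{2(n-1)(n-2)\omega_{n-1}\mathfrak m}\int_{S_r}\big(\mathrm{Ric}-\tfrac12R_gg\big)(Y_{(\alpha)},\nu_g)\,d\sigma_g$ with $Y_{(\alpha)}=(|x|^2\delta^{\alpha i}-2x^\alpha x^i)\partial_{x^i}$; $\mathbf c_{CS}(r)=(c^1_{CS}(r),\dots,c^n_{CS}(r))$, $\mathbf c_I(r)=(c^1_I(r),\dots,c^n_I(r))$. *)

theory Defs
  imports "HOL-Analysis.Analysis"
begin

definition pd :: "(real^'n \<Rightarrow> real) \<Rightarrow> 'n \<Rightarrow> real^'n \<Rightarrow> real" where
  "pd f i x = frechet_derivative f (at x) (axis i 1)"

fun pds :: "(real^'n \<Rightarrow> real) \<Rightarrow> 'n list \<Rightarrow> real^'n \<Rightarrow> real" where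
  "pds f [] = f"
| "pds f (i # is) = pd (pds f is) i"

fun Ck :: "nat \<Rightarrow> (real^'n) set \<Rightarrow> (real^'n \<Rightarrow> real) \<Rightarrow> bool" where
  "Ck 0 U f = continuous_on U f"
| "Ck (Suc k) U f = (f differentiable_on U \<and> (\<forall>i. Ck k U (pd f i)))"

definition small_o :: "nat \<Rightarrow> real \<Rightarrow> (real^'n \<Rightarrow> real) \<Rightarrow> bool" where
  "small_o k \<tau> f \<longleftrightarrow> (\<exists>R. Ck k {x. R < norm x} f) \<and>
     (\<forall>is. length is \<le> k \<longrightarrow>
        ((\<lambda>x. norm x powr (real (length is) + \<tau>) * \<bar>pds f is x\<bar>) \<longlongrightarrow> 0) at_infinity)"

definition oddpart :: "(real^'n \<Rightarrow> real) \<Rightarrow> real^'n \<Rightarrow> real" where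
  "oddpart f x = (f x - f (- x)) / 2"

definition riemannian_near_infinity :: "('n \<Rightarrow> 'n \<Rightarrow> real^'n \<Rightarrow> real) \<Rightarrow> bool" where
  "riemannian_near_infinity g \<longleftrightarrow> (\<exists>R. \<forall>x. R < norm x \<longrightarrow>
     (\<forall>i j. g i j x = g j i x) \<and>
     (\<forall>v::real^'n. v \<noteq> 0 \<longrightarrow> (\<Sum>i\<in>UNIV. \<Sum>j\<in>UNIV. g i j x * v$i * v$j) > 0))"

definition nu_e :: "real^'n \<Rightarrow> real^'n" where
  "nu_e x = x /\<^sub>R norm x"

text \<open>Integral over S_r w.r.t. the Euclidean area element; the surface measure of the unit
  sphere is given by the cone formula  int_{S^{n-1}} h = n int_{B(1)} h(y/|y|) dy.\<close>
definition sphere_int :: "real \<Rightarrow> (real^('n::finite) \<Rightarrow> real) \<Rightarrow> real" where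
  "sphere_int r f = r ^ (CARD('n) - 1) * real CARD('n) *
     integral (ball 0 1) (\<lambda>y::real^'n. f (r *\<^sub>R (y /\<^sub>R norm y)))"

definition omega :: "('n::finite) itself \<Rightarrow> real" where
  "omega _ = sphere_int 1 (\<lambda>_::real^'n. 1)"

definition gmat :: "('n \<Rightarrow> 'n \<Rightarrow> real^'n \<Rightarrow> real) \<Rightarrow> real^'n \<Rightarrow> real^'n^'n" where
  "gmat g x = (\<chi> i j. g i j x)"

definition ginv :: "('n \<Rightarrow> 'n \<Rightarrow> real^'n \<Rightarrow> real) \<Rightarrow> 'n \<Rightarrow> 'n \<Rightarrow> real^'n \<Rightarrow> real" where
  "ginv g i j x = matrix_inv (gmat g x) $ i $ j"

definition christoffel :: "('n \<Rightarrow> 'n \<Rightarrow> real^'n \<Rightarrow> real) \<Rightarrow> 'n \<Rightarrow> 'n \<Rightarrow> 'n \<Rightarrow> real^'n \<Rightarrow> real" where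
  "christoffel g k i j x = 1/2 * (\<Sum>l\<in>UNIV. ginv g k l x *
      (pd (g l i) j x + pd (g l j) i x - pd (g i j) l x))"

definition ricci :: "('n \<Rightarrow> 'n \<Rightarrow> real^'n \<Rightarrow> real) \<Rightarrow> 'n \<Rightarrow> 'n \<Rightarrow> real^'n \<Rightarrow> real" where
  "ricci g i j x = (\<Sum>k\<in>UNIV. pd (christoffel g k i j) k x - pd (christoffel g k i k) j x)
     + (\<Sum>k\<in>UNIV. \<Sum>l\<in>UNIV. christoffel g k k l x * christoffel g l i j x
                           - christoffel g k j l x * christoffel g l i k x)"

definition scal :: "('n \<Rightarrow> 'n \<Rightarrow> real^'n \<Rightarrow> real) \<Rightarrow> real^'n \<Rightarrow> real" where
  "scal g x = (\<Sum>i\<in>UNIV. \<Sum>j\<in>UNIV. ginv g i j x * ricci g i j x)"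

definition einstein :: "('n \<Rightarrow> 'n \<Rightarrow> real^'n \<Rightarrow> real) \<Rightarrow> 'n \<Rightarrow> 'n \<Rightarrow> real^'n \<Rightarrow> real" where
  "einstein g i j x = ricci g i j x - scal g x / 2 * g i j x"

definition conormal_len :: "('n \<Rightarrow> 'n \<Rightarrow> real^'n \<Rightarrow> real) \<Rightarrow> real^'n \<Rightarrow> real" where
  "conormal_len g x = sqrt (\<Sum>k\<in>UNIV. \<Sum>l\<in>UNIV. ginv g k l x * nu_e x $ k * nu_e x $ l)"

definition nu_g :: "('n \<Rightarrow> 'n \<Rightarrow> real^'n \<Rightarrow> real) \<Rightarrow> real^'n \<Rightarrow> real^'n" where
  "nu_g g x = (\<chi> j. (\<Sum>k\<in>UNIV. ginv g j k x * nu_e x $ k) / conormal_len g x)"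

text \<open>Density of the induced area element: d sigma_g = sqrt(det g) |d|x||_g d sigma_e.\<close>
definition area_g :: "('n \<Rightarrow> 'n \<Rightarrow> real^'n \<Rightarrow> real) \<Rightarrow> real^'n \<Rightarrow> real" where
  "area_g g x = sqrt (det (gmat g x)) * conormal_len g x"

definition Yfield :: "'n \<Rightarrow> real^'n \<Rightarrow> real^'n" where
  "Yfield a x = (\<chi> i. (norm x)^2 * (if a = i then 1 else 0) - 2 * x $ a * x $ i)"

definition adm_mass_r :: "('n::finite \<Rightarrow> 'n \<Rightarrow> real^'n \<Rightarrow> real) \<Rightarrow> real \<Rightarrow> real" where
  "adm_mass_r g r = 1 / (2 * (real CARD('n) - 1) * omega TYPE('n)) *
     sphere_int r (\<lambda>x. \<Sum>i\<in>UNIV. \<Sum>j\<in>UNIV. (pd (g i j) j x - pd (g j j) i x) * nu_e x $ i)"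

definition c_CS :: "('n::finite \<Rightarrow> 'n \<Rightarrow> real^'n \<Rightarrow> real) \<Rightarrow> real \<Rightarrow> real \<Rightarrow> real^'n" where
  "c_CS g m r = (\<chi> a. 1 / (2 * (real CARD('n) - 1) * omega TYPE('n) * m) *
     sphere_int r (\<lambda>x. (\<Sum>i\<in>UNIV. \<Sum>j\<in>UNIV. x $ a * (pd (g i j) i x - pd (g i i) j x) * nu_e x $ j)
        - ((\<Sum>i\<in>UNIV. g i a x * nu_e x $ i) - (\<Sum>i\<in>UNIV. g i i x) * nu_e x $ a)))"

definition c_I :: "('n::finite \<Rightarrow> 'n \<Rightarrow> real^'n \<Rightarrow> real) \<Rightarrow> real \<Rightarrow> real \<Rightarrow> real^'n" where
  "c_I g m r = (\<chi> a. 1 / (2 * (real CARD('n) - 1) * (real CARD('n) - 2) * omega TYPE('n) * m) *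
     sphere_int r (\<lambda>x. (\<Sum>i\<in>UNIV. \<Sum>j\<in>UNIV. einstein g i j x * Yfield a x $ i * nu_g g x $ j)
        * area_g g x))"

end

theory Submission
  imports Defs
begin

text \<open>
  Let \<open>\<tau> = (n - 2) / 2\<close>. Both integrals are compared with the flux of the linearised Einstein tensor \<open>E\<close> of \<open>g\<close>
  against the conformal Killing field \<open>Y\<close>.

  On every sphere the linear comparison is exact: if \<open>U\<close> denotes the vector field in the integrand of \<open>c_CS\<close>, then
  \<open>E\<^sub>i\<^sub>j Y\<^sub>i - (n - 2) U\<^sub>j = \<partial>\<^sub>k A\<^sub>j\<^sub>k\<close> for an explicit antisymmetric \<open>A\<close> built from \<open>g\<close> and its first derivatives,
  and the normal component of such a divergence is a combination of rotation derivatives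
  \<open>x\<^sub>j \<partial>\<^sub>k - x\<^sub>k \<partial>\<^sub>j\<close>, which integrate to zero over spheres by rotation invariance.

  The nonlinear remainder is only of size \<open>o(|x| powr -n)\<close>, one power too large. But
  \<open>Y\<close> is even and the normal is odd, so only its odd part is integrated, and each
  product of factors that are even or odd up to one better power of \<open>|x|\<close> inherits this gain.
\<close>

section \<open>Integration over spheres\<close>

text \<open>The potential \<open>A\<close> must be explicit because \<open>g\<close> lives only near
  infinity: there is no interior for the divergence theorem, and knowing merely that
  \<open>E Y - (n - 2) U\<close> is divergence free would make its flux independent of
  \<open>r\<close>, not zero. That it is divergence free explains the factor \<open>n - 2\<close>.
  The tensor \<open>E\<close> is symmetric and divergence free, its trace is (2 - n)/2 times the
  linearised scalar curvature \<open>R\<close>, and the symmetrised gradient of \<open>Y\<close> is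
  pure trace: \<open>d_i Y_j + d_j Y_i = -4 x_a kd i j\<close>. Hence div(E Y) = (n - 2) x_a R,
  while div U = x_a R. To find \<open>A\<close>, write \<open>E\<close> as the divergence of a
  \<open>B\<close> antisymmetric in its last two indices. Contracting \<open>B\<close> with
  \<open>Y\<close> gives a first candidate; the Leibniz term, \<open>B\<close> against the gradient
  of \<open>Y\<close>, is what the remaining part of \<open>A\<close> repairs. Power count: terms
  quadratic in \<open>g - kd\<close> and its derivatives, two derivatives in all, are
  o(|x|^(-2\<tau>-2)) = o(|x|^(-n)); \<open>Y\<close> contributes |x|^2 and the area r^(n-1), so the
  crude bound on the remainder is o(r). One more power, gained from parity, makes it o(1).\<close>

text \<open>
  Almost all of \<open>U\<close> is a disjoint union of balls, which \<open>Q\<close> maps to balls of the same radius. (The library's change of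
  variables would restrict the dimension to a well-ordered index type.)
\<close>

lemma emeasure_lborel_vimage_orthogonal:
  fixes Q :: "'a::euclidean_space \<Rightarrow> 'a"
  assumes Q: "orthogonal_transformation Q" and U: "open U"
  shows "emeasure lborel (Q -` U) = emeasure lborel U"
proof -
  have lin: "linear Q" and bij: "bij Q"
    using Q orthogonal_transformation_bij orthogonal_transformation_linear by auto
  have Qi: "orthogonal_transformation (inv Q)"
    using Q orthogonal_transformation_inv by blast
  have vim: "Q -` S = inv Q ` S" for S
    using bij by (simp add: bij_vimage_eq_inv_image)
  have isom: "dist (Q x) (Q y) = dist x y" for x y
    using Q orthogonal_transformation_isometry by blast
  have [measurable]: "Q \<in> borel_measurable borel"
    using lin linear_continuous_on linear_linear borel_measurable_continuous_onI by blast
  define K where "K = {(x, e). 0 < e \<and> ball x e \<subseteq> U}"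
  have fine: "\<exists>i. i \<in> K \<and> x \<in> ball (fst i) (snd i) \<and> snd i < d" if "x \<in> U" "0 < d" for x d
  proof -
    obtain e where e: "e > 0" "ball x e \<subseteq> U"
      using U \<open>x \<in> U\<close> open_contains_ball by blast
    have "(x, min e (d/2)) \<in> K"
      using e that by (auto simp: K_def)
    then show ?thesis
      using e that by (intro exI[of _ "(x, min e (d/2))"]) auto
  qed
  obtain C where C: "countable C" "C \<subseteq> K"
    "pairwise (\<lambda>i j. disjnt (ball (fst i) (snd i)) (ball (fst j) (snd j))) C"
    and N: "negligible (U - (\<Union>i \<in> C. ball (fst i) (snd i)))"
    by (rule Vitali_covering_theorem_balls[of U K fst snd, OF fine]) auto
  let ?B = "\<lambda>i. ball (fst i) (snd i)"
  let ?N = "U - (\<Union>i\<in>C. ball (fst i) (snd i))"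
  have Ueq: "U = (\<Union>i\<in>C. ?B i) \<union> ?N"
  proof -
    have "?B i \<subseteq> U" if "i \<in> C" for i
      using that C(2) by (cases i) (auto simp: K_def)
    then show ?thesis by blast
  qed
  have mN: "?N \<in> sets borel"
    using U by (intro sets.Diff borel_open open_UN ballI) simp_all
  have mB: "(\<Union>i\<in>C. ?B i) \<in> sets borel"
    by (intro borel_open open_UN ballI) simp
  have disj: "disjoint_family_on ?B C"
    using C(3) by (auto simp: disjoint_family_on_def pairwise_def disjnt_def)
  have vB: "Q -` ?B i = ball (inv Q (fst i)) (snd i)" for i
  proof -
    have "Q (inv Q (fst i)) = fst i"
      using bij by (simp add: bij_is_surj surj_f_inv_f)
    then show ?thesis
      using isom[of "inv Q (fst i)"] by auto
  qed
  have emB: "emeasure lborel (Q -` ?B i) = emeasure lborel (?B i)" if "i \<in> C" for i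
  proof -
    have "snd i \<ge> 0" using that C(2) by (auto simp: K_def)
    then show ?thesis
      unfolding vB using emeasure_lebesgue_ball_conv_unit_ball[of "snd i" "fst i"]
        emeasure_lebesgue_ball_conv_unit_ball[of "snd i" "inv Q (fst i)"] by simp
  qed
  \<comment> \<open>The set left uncovered by the balls is only known to be negligible, so its
    preimage must be shown null separately; a linear map sends negligible sets to negligible
    sets.\<close>
  have "negligible (inv Q ` ?N)"
    using N Qi
    by (intro negligible_differentiable_image_negligible)
       (auto simp: orthogonal_transformation_linear linear_imp_differentiable_on)
  then have negv: "negligible (Q -` ?N)"
    by (simp add: vim)
  have mv: "Q -` S \<in> sets borel" if "S \<in> sets borel" for S
    using measurable_sets[OF \<open>Q \<in> borel_measurable borel\<close> that] by simp
  have nullI: "emeasure lborel S = 0" if "negligible S" "S \<in> sets borel" for S :: "'a set"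
    using that null_sets_completion_iff[of S lborel] by (simp add: negligible_iff_null_sets null_sets_def)
  have null: "emeasure lborel (Q -` ?N) = 0"
    using nullI[OF negv mv[OF mN]] .
  have null0: "emeasure lborel ?N = 0"
    using nullI[OF N mN] .
  have "emeasure lborel U = emeasure lborel (\<Union>i\<in>C. ?B i) + emeasure lborel ?N"
  proof -
    have "emeasure lborel (\<Union>i\<in>C. ?B i) + emeasure lborel ?N = emeasure lborel ((\<Union>i\<in>C. ?B i) \<union> ?N)"
      by (rule plus_emeasure) (use mN mB in simp_all)
    then show ?thesis using Ueq by simp
  qed
  also have "\<dots> = (\<integral>\<^sup>+i. emeasure lborel (?B i) \<partial>count_space C)"
    using disj C(1) null0 by (subst emeasure_UN_countable) auto
  also have "\<dots> = (\<integral>\<^sup>+i. emeasure lborel (Q -` ?B i) \<partial>count_space C)"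
    using emB by (intro nn_integral_cong) auto
  also have "\<dots> = emeasure lborel (\<Union>i\<in>C. Q -` ?B i)"
  proof (intro emeasure_UN_countable[symmetric])
    show "disjoint_family_on (\<lambda>i. Q -` ?B i) C"
      using disj unfolding disjoint_family_on_def by blast
  qed (use C(1) in \<open>simp_all add: vB\<close>)
  also have "\<dots> = emeasure lborel (\<Union>i\<in>C. Q -` ?B i) + emeasure lborel (Q -` ?N)"
    using null by simp
  also have "\<dots> = emeasure lborel ((\<Union>i\<in>C. Q -` ?B i) \<union> Q -` ?N)"
    using mv[OF mN] mv[OF mB] by (intro plus_emeasure) (auto simp: vimage_UN)
  also have "(\<Union>i\<in>C. Q -` ?B i) \<union> Q -` ?N = Q -` U"
    using Ueq by blast
  finally show ?thesis ..
qed

text \<open>Lebesgue measure is determined by its values on boxes. The preimage of a box under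
  \<open>Q\<close> is no longer a box, only an open set, which is why the preceding lemma treats all
  open sets.\<close>

lemma lborel_distr_orthogonal:
  fixes Q :: "'a::euclidean_space \<Rightarrow> 'a"
  assumes Q: "orthogonal_transformation Q"
  shows "distr lborel borel Q = lborel"
proof (rule lborel_eqI[symmetric])
  have "linear Q" using Q orthogonal_transformation_linear by blast
  then have [measurable]: "Q \<in> borel_measurable borel"
    using linear_continuous_on linear_linear borel_measurable_continuous_onI by blast
  show "emeasure (distr lborel borel Q) (box l u) = ennreal (\<Prod>b\<in>Basis. (u - l) \<bullet> b)"
    if "\<And>b. b \<in> Basis \<Longrightarrow> l \<bullet> b \<le> u \<bullet> b" for l u
    using that emeasure_lborel_vimage_orthogonal[OF Q, of "box l u"] by (simp add: emeasure_distr open_box emeasure_lborel_box)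
qed auto

lemma integral_ball_orthogonal:
  fixes Q :: "'a::euclidean_space \<Rightarrow> 'a" and f :: "'a \<Rightarrow> real"
  assumes Q: "orthogonal_transformation Q" and f: "set_integrable lborel (ball 0 r) f"
  shows "integral (ball 0 r) (\<lambda>x. f (Q x)) = integral (ball 0 r) f"
proof -
  have ind: "indicator (ball 0 r) (Q x) = (indicator (ball 0 r) x :: real)" for x
    using orthogonal_transformation_norm[OF Q] by (simp add: indicator_def)
  have "linear Q" using Q orthogonal_transformation_linear by blast
  then have [measurable]: "Q \<in> borel_measurable borel"
    using linear_continuous_on linear_linear borel_measurable_continuous_onI by blast
  define h where "h = (\<lambda>x. indicator (ball 0 r) x *\<^sub>R f x)"
  have h: "integrable lborel h"
    using f by (simp add: set_integrable_def h_def)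
  then have [measurable]: "h \<in> borel_measurable borel" by auto
  have "integrable lborel (\<lambda>x. h (Q x))"
    using h integrable_distr_eq[of Q lborel borel h] lborel_distr_orthogonal[OF Q] by simp
  then have f': "set_integrable lborel (ball 0 r) (\<lambda>x. f (Q x))"
    by (simp add: set_integrable_def h_def ind)
  have "(\<integral>x. h (Q x) \<partial>lborel) = (\<integral>x. h x \<partial>lborel)"
    using integral_distr[of Q lborel borel h] lborel_distr_orthogonal[OF Q] by simp
  then show ?thesis
    using set_borel_integral_eq_integral(2)[OF f] set_borel_integral_eq_integral(2)[OF f']
    by (simp add: set_lebesgue_integral_def h_def ind)
qed

lemma radial_set_integrable:
  fixes f :: "'a::euclidean_space \<Rightarrow> real"
  assumes r: "r > 0" and f: "continuous_on (sphere 0 r) f"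
  shows "set_integrable lborel (ball 0 1) (\<lambda>y. f (r *\<^sub>R (y /\<^sub>R norm y)))"
proof -
  let ?F = "\<lambda>y. f (r *\<^sub>R (y /\<^sub>R norm y))"
  have "compact (f ` sphere 0 r)"
    using f compact_continuous_image compact_sphere by blast
  then obtain B where B: "\<And>x. x \<in> sphere 0 r \<Longrightarrow> \<bar>f x\<bar> \<le> B"
    using compact_imp_bounded bounded_real by (metis (no_types, lifting) imageI)
  have sph: "r *\<^sub>R (y /\<^sub>R norm y) \<in> sphere 0 r" if "y \<noteq> 0" for y :: 'a
    using that r by simp
  have "continuous_on (ball 0 1 - {0}) ?F"
  proof (rule continuous_on_compose2[OF f])
    show "(\<lambda>y::'a. r *\<^sub>R (y /\<^sub>R norm y)) ` (ball 0 1 - {0}) \<subseteq> sphere 0 r"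
      using sph by blast
  qed (auto intro!: continuous_intros)
  then have "set_borel_measurable borel (ball 0 1 - {0}) ?F"
    unfolding set_borel_measurable_def
    by (intro borel_measurable_continuous_on_indicator) auto
  then have "set_integrable lborel (ball 0 1 - {0}) ?F"
    unfolding set_integrable_def set_borel_measurable_def
  proof (intro integrableI_bounded_set[where A="ball 0 1 - {0}" and B=B] AE_I2 impI)
    show "emeasure lborel (ball (0::'a) 1 - {0}) < \<infinity>"
      by (rule le_less_trans[OF emeasure_mono emeasure_lborel_ball_finite[of "0::'a" 1]]) auto
    show "norm (indicat_real (ball 0 1 - {0}) x *\<^sub>R ?F x) \<le> B" if "x \<in> ball 0 1 - {0}" for x
      using that B[OF sph[of x]] by auto
  qed auto
  \<comment> \<open>At the origin \<open>y /\<^sub>R norm y\<close> evaluates to 0, so the integrand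
    is \<open>f 0\<close> there, a value off the sphere that no hypothesis controls; being attained
    on a single null point, it does no harm.\<close>
  moreover have "set_integrable lborel {0} ?F"
  proof -
    have "(\<lambda>x. indicat_real {0} x *\<^sub>R ?F x) = (\<lambda>x. indicat_real {0} x *\<^sub>R f 0)"
      by (auto simp: fun_eq_iff indicator_def)
    then show ?thesis
      by (simp add: set_integrable_def)
  qed
  ultimately have "set_integrable lborel ((ball 0 1 - {0}) \<union> {0}) ?F"
    by (rule set_integrable_Un) auto
  then show ?thesis
    by (simp add: insert_absorb)
qed

lemma radial_integrable_on:
  fixes f :: "'a::euclidean_space \<Rightarrow> real"
  assumes "r > 0" "continuous_on (sphere 0 r) f"
  shows "(\<lambda>y. f (r *\<^sub>R (y /\<^sub>R norm y))) integrable_on (ball 0 1)"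
  using radial_set_integrable[OF assms] set_borel_integral_eq_integral(1) by blast

lemma sphere_int_cong:
  assumes "r > 0" "\<And>x. norm x = r \<Longrightarrow> f x = g x"
  shows "sphere_int r f = sphere_int r g"
proof -
  have "integral (ball 0 1) (\<lambda>y. f (r *\<^sub>R (y /\<^sub>R norm y))) =
        integral (ball 0 1) (\<lambda>y. g (r *\<^sub>R (y /\<^sub>R norm y)))"
    by (rule integral_spike[of "{0}"]) (use assms in auto)
  then show ?thesis by (simp add: sphere_int_def)
qed

lemma sphere_int_add:
  assumes "r > 0" "continuous_on (sphere 0 r) f" "continuous_on (sphere 0 r) g"
  shows "sphere_int r (\<lambda>x. f x + g x) = sphere_int r f + sphere_int r g"
  unfolding sphere_int_def
  by (subst integral_add) (use radial_integrable_on assms in \<open>auto simp: algebra_simps\<close>)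

lemma sphere_int_cmult: "sphere_int r (\<lambda>x. c * f x) = c * sphere_int r f"
  by (simp add: sphere_int_def)

lemma sphere_int_diff:
  assumes "r > 0" "continuous_on (sphere 0 r) f" "continuous_on (sphere 0 r) g"
  shows "sphere_int r (\<lambda>x. f x - g x) = sphere_int r f - sphere_int r g"
  using sphere_int_add[of r f "\<lambda>x. -1 * g x"] sphere_int_cmult[of r "-1" g] assms
  by (auto intro!: continuous_intros)

lemma sphere_int_sum:
  assumes "r > 0" "\<And>i. i \<in> I \<Longrightarrow> continuous_on (sphere 0 r) (f i)"
  shows "sphere_int r (\<lambda>x. \<Sum>i\<in>I. f i x) = (\<Sum>i\<in>I. sphere_int r (f i))"
  using assms(2)
proof (induction I rule: infinite_finite_induct)
  case (insert i I)
  then show ?case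
    using assms(1) by (simp add: sphere_int_add continuous_on_sum)
qed (auto simp: sphere_int_def)

lemma sphere_int_orthogonal:
  fixes f :: "real^'n \<Rightarrow> real" and Q :: "real^'n \<Rightarrow> real^'n"
  assumes "r > 0" "continuous_on (sphere 0 r) f" "orthogonal_transformation Q"
  shows "sphere_int r (\<lambda>x. f (Q x)) = sphere_int r f"
proof -
  have "Q (r *\<^sub>R (y /\<^sub>R norm y)) = r *\<^sub>R (Q y /\<^sub>R norm (Q y))" for y
    using assms(3) by (simp add: orthogonal_transformation_linear linear_scale orthogonal_transformation_norm)
  then show ?thesis
    using integral_ball_orthogonal[OF assms(3), of 1 "\<lambda>y. f (r *\<^sub>R (y /\<^sub>R norm y))"]
      radial_set_integrable[OF assms(1,2)]
    by (simp add: sphere_int_def)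
qed

lemma sphere_int_bound:
  fixes f :: "real^'n \<Rightarrow> real"
  assumes r: "r > 0" and f: "continuous_on (sphere 0 r) f" and b: "\<And>x. norm x = r \<Longrightarrow> \<bar>f x\<bar> \<le> B"
  shows "\<bar>sphere_int r f\<bar> \<le> r ^ (CARD('n) - 1) * omega TYPE('n) * B"
proof -
  \<comment> \<open>The value at the origin is reset to 0, since \<open>B\<close> bounds
    \<open>f\<close> only on the sphere.\<close>
  let ?h = "\<lambda>y::real^'n. if y = 0 then 0 else f (r *\<^sub>R (y /\<^sub>R norm y))"
  have "norm (integral (ball 0 1) ?h) \<le> integral (ball 0 1) (\<lambda>y::real^'n. B)"
  proof (rule integral_norm_bound_integral)
    show "?h integrable_on ball 0 1"
      by (rule integrable_spike[OF radial_integrable_on[OF r f] negligible_sing[of 0]]) auto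
    show "(\<lambda>y. B) integrable_on ball (0::real^'n) 1"
      by (rule integrable_on_const) auto
    obtain x :: "real^'n" where "norm x = r"
      using r vector_choose_size[of r] by auto
    then have "B \<ge> 0" using b[of x] by linarith
    then show "norm (?h y) \<le> B" if "y \<in> ball 0 1" for y
      using b[of "r *\<^sub>R (y /\<^sub>R norm y)"] r by auto
  qed
  moreover have "integral (ball 0 1) ?h = integral (ball 0 1) (\<lambda>y. f (r *\<^sub>R (y /\<^sub>R norm y)))"
    by (rule integral_spike[OF negligible_sing[of 0]]) auto
  moreover have "integral (ball (0::real^'n) 1) (\<lambda>y. B) = B * integral (ball (0::real^'n) 1) (\<lambda>y. 1)"
    using integral_mult_right[of "ball (0::real^'n) 1" B "\<lambda>_. 1"] by simp
  ultimately show ?thesis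
    using r by (simp add: sphere_int_def omega_def abs_mult mult_left_mono mult.assoc mult.commute[of B])
qed

text \<open>Serves to pass to the limit in difference quotients along a rotation.\<close>

lemma sphere_int_dominated:
  fixes f :: "nat \<Rightarrow> real^'n \<Rightarrow> real"
  assumes r: "r > 0" and f: "\<And>m. continuous_on (sphere 0 r) (f m)"
    and B: "\<And>m x. norm x = r \<Longrightarrow> \<bar>f m x\<bar> \<le> B"
    and conv: "\<And>x. norm x = r \<Longrightarrow> (\<lambda>m. f m x) \<longlonglongrightarrow> g x"
  shows "(\<lambda>m. sphere_int r (f m)) \<longlonglongrightarrow> sphere_int r g"
proof -
  let ?p = "\<lambda>f y::real^'n. if y = 0 then 0 else f (r *\<^sub>R (y /\<^sub>R norm y))"
  have eq: "integral (ball 0 1) (?p h) = integral (ball 0 1) (\<lambda>y::real^'n. h (r *\<^sub>R (y /\<^sub>R norm y)))"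
    for h :: "real^'n \<Rightarrow> real"
    by (rule integral_spike[OF negligible_sing[of 0]]) auto
  have n: "norm (r *\<^sub>R (y /\<^sub>R norm y)) = r" if "y \<noteq> 0" for y :: "real^'n"
    using that r by simp
  have "(\<lambda>m. integral (ball 0 1) (?p (f m))) \<longlonglongrightarrow> integral (ball 0 1) (?p g)"
  proof (rule dominated_convergence(2))
    show "?p (f m) integrable_on ball 0 1" for m
      by (rule integrable_spike[OF radial_integrable_on[OF r f] negligible_sing[of 0]]) auto
    show "(\<lambda>y. \<bar>B\<bar>) integrable_on ball (0::real^'n) 1"
      by (rule integrable_on_const) auto
    show "norm (?p (f m) y) \<le> \<bar>B\<bar>" for m y
      using B[OF n[of y], of m] by auto
    show "(\<lambda>m. ?p (f m) y) \<longlonglongrightarrow> ?p g y" for y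
      using conv[OF n[of y]] by auto
  qed
  then have "(\<lambda>m. integral (ball 0 1) (\<lambda>y::real^'n. f m (r *\<^sub>R (y /\<^sub>R norm y))))
      \<longlonglongrightarrow> integral (ball 0 1) (\<lambda>y. g (r *\<^sub>R (y /\<^sub>R norm y)))"
    by (simp only: eq)
  then show ?thesis
    unfolding sphere_int_def by (rule tendsto_mult_left)
qed

section \<open>Rotations in coordinate planes and the vanishing of integrated rotation
  derivatives\<close>

definition plane_rotation :: "'n::finite \<Rightarrow> 'n \<Rightarrow> real \<Rightarrow> real^'n \<Rightarrow> real^'n" where
  "plane_rotation j k t x = x + ((cos t - 1) * x$j - sin t * x$k) *\<^sub>R axis j 1
     + (sin t * x$j + (cos t - 1) * x$k) *\<^sub>R axis k 1"

lemma orthogonal_plane_rotation: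
  fixes j k :: "'n::finite"
  assumes "j \<noteq> k"
  shows "orthogonal_transformation (plane_rotation j k t)"
  unfolding orthogonal_transformation
proof (intro conjI allI)
  show "linear (plane_rotation j k t)"
    by (rule linearI) (auto simp: plane_rotation_def algebra_simps)
  fix x :: "real^'n"
  define a b where "a = (cos t - 1) * x$j - sin t * x$k" and "b = sin t * x$j + (cos t - 1) * x$k"
  have R: "plane_rotation j k t x = x + a *\<^sub>R axis j 1 + b *\<^sub>R axis k 1"
    by (simp add: plane_rotation_def a_def b_def)
  have "plane_rotation j k t x \<bullet> plane_rotation j k t x = x \<bullet> x + (2 * a * x$j + 2 * b * x$k + a^2 + b^2)"
  proof -
    have [simp]: "axis j (1::real) $ j = 1" "axis k (1::real) $ k = 1" "axis j (1::real) $ k = 0" "axis k (1::real) $ j = 0"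
      using assms by (auto simp: axis_def)
    show ?thesis
      unfolding R by (simp add: inner_simps inner_axis inner_axis' power2_eq_square algebra_simps)
  qed
  \<comment> \<open>Stated as a polynomial identity in \<open>sin t\<close> and
    \<open>cos t\<close>; the first factor then vanishes by sin^2 + cos^2 = 1.\<close>
  also have "2 * a * x$j + 2 * b * x$k + a^2 + b^2
      = ((sin t)\<^sup>2 + (cos t)\<^sup>2 - 1) * ((x$j)\<^sup>2 + (x$k)\<^sup>2)"
    unfolding a_def b_def by algebra
  finally show "norm (plane_rotation j k t x) = norm x"
    by (simp add: norm_eq)
qed

text \<open>The derivative is expressed at the rotated point: the rotations are the flow of the
  field \<open>x_j d_k - x_k d_j\<close>. At every time \<open>t\<close> the derivative of
  \<open>f\<close> along the flow is thus a value of that field applied to \<open>f\<close> at a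
  point of the same sphere.\<close>

lemma plane_rotation_has_vector_derivative:
  assumes "j \<noteq> k"
  shows "((\<lambda>t. plane_rotation j k t x) has_vector_derivative
      (plane_rotation j k t x $ j) *\<^sub>R axis k 1 - (plane_rotation j k t x $ k) *\<^sub>R axis j 1) (at t)"
proof -
  have "plane_rotation j k t x $ j = cos t * x$j - sin t * x$k"
    "plane_rotation j k t x $ k = sin t * x$j + cos t * x$k"
    using assms by (auto simp: plane_rotation_def axis_def algebra_simps)
  then show ?thesis
    unfolding plane_rotation_def
    by (auto intro!: derivative_eq_intros simp: has_vector_derivative_def fun_eq_iff algebra_simps)
qed

lemma plane_rotation_has_field_derivative:
  fixes f :: "real^'n \<Rightarrow> real"
  assumes "j \<noteq> k" "f differentiable (at (plane_rotation j k t x))"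
  shows "((\<lambda>t. f (plane_rotation j k t x)) has_real_derivative
      (plane_rotation j k t x $ j * pd f k (plane_rotation j k t x)
        - plane_rotation j k t x $ k * pd f j (plane_rotation j k t x))) (at t)"
proof -
  let ?y = "plane_rotation j k t x" and ?D = "frechet_derivative f (at (plane_rotation j k t x))"
  have D: "(f has_derivative ?D) (at ?y)"
    using assms(2) frechet_derivative_works by blast
  then interpret D: linear ?D
    by (rule has_derivative_linear)
  have "((\<lambda>t. f (plane_rotation j k t x)) has_vector_derivative
      ?D ((?y $ j) *\<^sub>R axis k 1 - (?y $ k) *\<^sub>R axis j 1)) (at t)"
    using vector_derivative_diff_chain_within[OF plane_rotation_has_vector_derivative[OF assms(1)]
      has_derivative_at_withinI[OF D]] by (simp add: o_def)
  then show ?thesis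
    by (simp add: has_real_derivative_iff_has_vector_derivative D.diff D.scale pd_def)
qed

text \<open>By rotation invariance the integral of \<open>f\<close> composed with the rotation by
  angle \<open>t\<close> does not depend on \<open>t\<close>, so every difference quotient in
  \<open>t\<close> integrates to 0. The mean value theorem bounds the quotients by the maximum of
  the rotation derivative over the sphere, which permits the limit \<open>t\<close> to 0 under the
  integral.\<close>

lemma sphere_int_rotation_field:
  fixes f :: "real^'n \<Rightarrow> real"
  assumes r: "r > 0" and jk: "j \<noteq> k"
    and d: "\<And>x. norm x = r \<Longrightarrow> f differentiable (at x)"
    and c: "\<And>i. continuous_on (sphere 0 r) (pd f i)"
  shows "sphere_int r (\<lambda>x. x$j * pd f k x - x$k * pd f j x) = 0"
proof -
  let ?L = "\<lambda>x. x$j * pd f k x - x$k * pd f j x" and ?R = "plane_rotation j k"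
  have "continuous_on (sphere 0 r) ?L"
    by (intro continuous_intros c)
  then have "compact (?L ` sphere 0 r)"
    using compact_continuous_image compact_sphere by blast
  then obtain B where "\<forall>y\<in>?L ` sphere 0 r. \<bar>y\<bar> \<le> B"
    using compact_imp_bounded bounded_real by blast
  then have B: "\<bar>?L x\<bar> \<le> B" if "norm x = r" for x
    using that by simp
  have nR: "norm (?R t x) = norm x" for t x
    using orthogonal_plane_rotation[OF jk] orthogonal_transformation_norm by blast
  have cf: "continuous_on (sphere 0 r) f"
    using d by (intro continuous_at_imp_continuous_on ballI differentiable_imp_continuous_within) auto
  have cfR: "continuous_on (sphere 0 r) (\<lambda>x. f (?R t x))" for t
  proof (rule continuous_on_compose2[OF cf])
    show "continuous_on (sphere 0 r) (?R t)"
      using orthogonal_transformation_linear[OF orthogonal_plane_rotation[OF jk]]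
      by (intro linear_continuous_on) (simp add: linear_conv_bounded_linear)
  qed (auto simp: nR)
  have R0: "?R 0 x = x" for x
    by (simp add: plane_rotation_def)
  have D: "((\<lambda>t. f (?R t x)) has_real_derivative ?L (?R t x)) (at t)" if "norm x = r" for x t
    using nR that by (intro plane_rotation_has_field_derivative[OF jk] d) simp
  define h where "h = (\<lambda>m x. (f (?R (1 / real (Suc m)) x) - f x) / (1 / real (Suc m)))"
  have "(\<lambda>m. sphere_int r (h m)) \<longlonglongrightarrow> sphere_int r ?L"
  proof (rule sphere_int_dominated[OF r])
    show "continuous_on (sphere 0 r) (h m)" for m
      unfolding h_def by (intro continuous_intros cf cfR) auto
    show "\<bar>h m x\<bar> \<le> B" if x: "norm x = r" for m x
    proof -
      obtain z where z: "f (?R (1 / real (Suc m)) x) - f (?R 0 x) = (1 / real (Suc m) - 0) * ?L (?R z x)"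
        using MVT2[of 0 "1 / real (Suc m)" "\<lambda>t. f (?R t x)" "\<lambda>t. ?L (?R t x)"] D[OF x] by auto
      have "h m x = ?L (?R z x)"
        using z by (simp add: h_def R0)
      then show ?thesis
        using B[of "?R z x"] nR x by simp
    qed
    show "(\<lambda>m. h m x) \<longlonglongrightarrow> ?L x" if "norm x = r" for x
    proof -
      have "((\<lambda>t. (f (?R t x) - f (?R 0 x)) / (t - 0)) \<longlongrightarrow> ?L x) (at 0)"
        using D[OF that, of 0] by (simp add: has_field_derivative_iff R0)
      moreover have "filterlim (\<lambda>m. 1 / real (Suc m)) (at 0) sequentially"
        using LIMSEQ_inverse_real_of_nat
        by (intro filterlim_atI) (auto simp: inverse_eq_divide)
      ultimately show ?thesis
        unfolding h_def using filterlim_compose by (fastforce simp: R0)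
    qed
  qed
  moreover have "sphere_int r (h m) = 0" for m
  proof -
    have "sphere_int r (\<lambda>x. f (?R (1 / real (Suc m)) x)) = sphere_int r f"
      by (rule sphere_int_orthogonal[OF r cf orthogonal_plane_rotation[OF jk]])
    then have "sphere_int r (\<lambda>x. f (?R (1 / real (Suc m)) x) - f x) = 0"
      using sphere_int_diff[OF r cfR cf] by simp
    then show ?thesis
      using sphere_int_cmult[of r "real (Suc m)" "\<lambda>x. f (?R (1 / real (Suc m)) x) - f x"]
      unfolding h_def by (simp add: mult.commute)
  qed
  ultimately show ?thesis
    by (simp add: LIMSEQ_const_iff)
qed

text \<open>Swapping \<open>j\<close> and \<open>k\<close> and using antisymmetry turns the normal
  component of the divergence into half the sum of the rotation derivatives
  \<open>x_j d_k - x_k d_j\<close> of \<open>A j k\<close>. This is Stokes' theorem on the closed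
  sphere, with no interior needed.\<close>

lemma sphere_int_divergence_antisym:
  fixes A :: "'n \<Rightarrow> 'n \<Rightarrow> real^'n \<Rightarrow> real"
  assumes r: "r > 0"
    and d: "\<And>j k x. norm x = r \<Longrightarrow> A j k differentiable (at x)"
    and c: "\<And>j k i. continuous_on (sphere 0 r) (pd (A j k) i)"
    and anti: "\<And>j k i x. norm x = r \<Longrightarrow> pd (A k j) i x = - pd (A j k) i x"
  shows "sphere_int r (\<lambda>x. \<Sum>j\<in>UNIV. \<Sum>k\<in>UNIV. x$j * pd (A j k) k x) = 0"
proof -
  let ?L = "\<lambda>j k x. x$j * pd (A j k) k x - x$k * pd (A j k) j x"
  have "sphere_int r (\<lambda>x. \<Sum>j\<in>UNIV. \<Sum>k\<in>UNIV. x$j * pd (A j k) k x)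
      = sphere_int r (\<lambda>x. 1/2 * (\<Sum>j\<in>UNIV. \<Sum>k\<in>UNIV. ?L j k x))"
  proof (rule sphere_int_cong[OF r])
    fix x :: "real^'n" assume x: "norm x = r"
    have "(\<Sum>j\<in>UNIV. \<Sum>k\<in>UNIV. x$k * pd (A j k) j x) = (\<Sum>k\<in>UNIV. \<Sum>j\<in>UNIV. x$k * pd (A j k) j x)"
      by (rule sum.swap)
    also have "\<dots> = - (\<Sum>k\<in>UNIV. \<Sum>j\<in>UNIV. x$k * pd (A k j) j x)"
    proof -
      have "x$k * pd (A j k) j x = - (x$k * pd (A k j) j x)" for j k
        by (subst anti[OF x, of k j j]) simp
      then have "(\<Sum>j\<in>UNIV. x$k * pd (A j k) j x) = (\<Sum>j\<in>UNIV. - (x$k * pd (A k j) j x))" for k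
        by (rule sum.cong[OF refl])
      then show ?thesis by (simp only: sum_negf)
    qed
    finally show "(\<Sum>j\<in>UNIV. \<Sum>k\<in>UNIV. x$j * pd (A j k) k x) = 1/2 * (\<Sum>j\<in>UNIV. \<Sum>k\<in>UNIV. ?L j k x)"
      by (simp add: sum_subtractf)
  qed
  also have "\<dots> = 1/2 * (\<Sum>j\<in>UNIV. \<Sum>k\<in>UNIV. sphere_int r (?L j k))"
  proof -
    have "continuous_on (sphere 0 r) (?L j k)" for j k
      by (intro continuous_intros c)
    then show ?thesis
      by (simp only: sphere_int_cmult sphere_int_sum[OF r] continuous_on_sum)
  qed
  also have "\<dots> = 0"
  proof -
    have "sphere_int r (?L j k) = 0" for j k
    proof (cases "j = k")
      case True
      then show ?thesis by (simp add: sphere_int_def)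
    next
      case False
      then show ?thesis using sphere_int_rotation_field[OF r False d c] by simp
    qed
    then show ?thesis by simp
  qed
  finally show ?thesis .
qed

section \<open>Calculus of partial derivatives\<close>

lemma pd_eqI: "(f has_derivative D) (at x) \<Longrightarrow> pd f i x = D (axis i 1)"
  unfolding pd_def using frechet_derivative_at by metis

lemma pd_has_derivative: "f differentiable (at x) \<Longrightarrow> (f has_derivative frechet_derivative f (at x)) (at x)"
  using frechet_derivative_works by blast

lemma pd_const [simp]: "pd (\<lambda>x. c) i = (\<lambda>x. 0)"
  by (rule ext, rule pd_eqI[where D="\<lambda>_. 0"]) simp

lemma pd_add:
  "f differentiable (at x) \<Longrightarrow> g differentiable (at x) \<Longrightarrow> pd (\<lambda>x. f x + g x) i x = pd f i x + pd g i x"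
  by (subst pd_eqI[OF has_derivative_add[OF pd_has_derivative pd_has_derivative]]) (simp_all add: pd_def)

lemma pd_diff:
  "f differentiable (at x) \<Longrightarrow> g differentiable (at x) \<Longrightarrow> pd (\<lambda>x. f x - g x) i x = pd f i x - pd g i x"
  by (subst pd_eqI[OF has_derivative_diff[OF pd_has_derivative pd_has_derivative]]) (simp_all add: pd_def)

lemma pd_mult:
  "f differentiable (at x) \<Longrightarrow> g differentiable (at x) \<Longrightarrow>
    pd (\<lambda>x. f x * g x) i x = pd f i x * g x + f x * pd g i x"
  by (subst pd_eqI[OF has_derivative_mult[OF pd_has_derivative pd_has_derivative]])
     (simp_all add: pd_def algebra_simps)

lemma pd_cmult: "f differentiable (at x) \<Longrightarrow> pd (\<lambda>x. c * f x) i x = c * pd f i x"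
  using pd_mult[of "\<lambda>_. c" x f i] by simp

lemma pd_sum:
  "(\<And>k. k \<in> I \<Longrightarrow> f k differentiable (at x)) \<Longrightarrow> pd (\<lambda>x. \<Sum>k\<in>I. f k x) i x = (\<Sum>k\<in>I. pd (f k) i x)"
  by (subst pd_eqI[OF has_derivative_sum[OF pd_has_derivative]]) (simp_all add: pd_def)

lemma differentiable_component [simp]: "(\<lambda>x::real^'n. x $ k) differentiable F"
  by (rule linear_imp_differentiable) (simp add: linear_iff)

lemma pd_component: "pd (\<lambda>x. x $ k) i x = (if k = i then 1 else 0)"
  by (subst pd_eqI[OF bounded_linear.has_derivative[OF bounded_linear_vec_nth has_derivative_ident]])
     (auto simp: axis_def)

lemma pd_cong:
  assumes "open U" "x \<in> U" "\<And>y. y \<in> U \<Longrightarrow> f y = g y"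
  shows "pd f i x = pd g i x"
proof -
  have "(f has_derivative D) (at x) \<longleftrightarrow> (g has_derivative D) (at x)" for D
    using has_derivative_transform_within_open[OF _ assms(1,2)] assms(3) by (metis (full_types))
  then show ?thesis
    unfolding pd_def frechet_derivative_def by simp
qed

text \<open>\<open>f\<close> and \<open>f - c\<close> have the same Frechet derivatives, so the
  choice operator inside \<open>frechet_derivative\<close> picks the same one, whether or not a
  derivative exists. The equation therefore holds between functions and can be used under a further
  \<open>pd\<close>.\<close>

lemma pd_diff_const: "pd (\<lambda>x. f x - c) i = pd f i"
proof -
  have "((\<lambda>x. f x - c) has_derivative D) (at x) \<longleftrightarrow> (f has_derivative D) (at x)" for D x
    using has_derivative_add_const[of "\<lambda>x. f x - c" D "at x" c] has_derivative_add_const[of f D "at x" "- c"] by auto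
  then show ?thesis
    unfolding pd_def frechet_derivative_def by simp
qed

lemma pd_uminus_arg:
  assumes "f differentiable (at (- x))"
  shows "pd (\<lambda>x. f (- x)) i x = - pd f i (- x)" and "(\<lambda>x. f (- x)) differentiable (at x)"
proof -
  have D: "(f has_derivative frechet_derivative f (at (- x))) (at (- x))"
    using assms frechet_derivative_works by blast
  then have lin: "linear (frechet_derivative f (at (- x)))"
    by (rule has_derivative_linear)
  have "((\<lambda>x. f (- x)) has_derivative (\<lambda>v. frechet_derivative f (at (- x)) (- v))) (at x)"
    using has_derivative_compose[OF has_derivative_minus[OF has_derivative_ident] D] by simp
  then show "pd (\<lambda>x. f (- x)) i x = - pd f i (- x)" "(\<lambda>x. f (- x)) differentiable (at x)"
    using lin pd_eqI[of "\<lambda>x. f (- x)"] by (auto simp: pd_def linear_neg differentiable_def)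
qed

section \<open>Symmetry of second partial derivatives\<close>

lemma has_real_derivative_along_axis:
  fixes f :: "real^'n \<Rightarrow> real"
  assumes "f differentiable (at (x + t *\<^sub>R axis i 1))"
  shows "((\<lambda>t. f (x + t *\<^sub>R axis i 1)) has_real_derivative pd f i (x + t *\<^sub>R axis i 1)) (at t)"
proof -
  have D: "(f has_derivative frechet_derivative f (at (x + t *\<^sub>R axis i 1))) (at (x + t *\<^sub>R axis i 1))"
    using assms frechet_derivative_works by blast
  have "((\<lambda>t. x + t *\<^sub>R axis i 1) has_derivative (\<lambda>s. s *\<^sub>R axis i 1)) (at t)"
    by (auto intro!: derivative_eq_intros)
  from has_derivative_compose[OF this D] show ?thesis
    using has_derivative_linear[OF D] by (simp add: has_field_derivative_def pd_def linear_scale mult_commute_abs)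
qed

lemma second_difference_mean_value:
  fixes f :: "real^'n \<Rightarrow> real"
  assumes h: "0 < h" "2 * h < e"
    and f: "\<And>y. y \<in> ball x e \<Longrightarrow> f differentiable (at y)"
    and f': "\<And>y. y \<in> ball x e \<Longrightarrow> pd f i differentiable (at y)"
  obtains y where "norm (y - x) \<le> 2 * h"
    "f (x + h *\<^sub>R axis i 1 + h *\<^sub>R axis j 1) - f (x + h *\<^sub>R axis i 1) - f (x + h *\<^sub>R axis j 1) + f x
       = h\<^sup>2 * pd (pd f i) j y"
proof -
  have nb: "norm (s *\<^sub>R axis i (1::real) + t *\<^sub>R axis j 1) \<le> 2 * h" if "0 \<le> s" "s \<le> h" "0 \<le> t" "t \<le> h" for s t
    by (rule order_trans[OF norm_triangle_ineq]) (use that in simp)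
  have inb: "x + s *\<^sub>R axis i 1 + t *\<^sub>R axis j 1 \<in> ball x e" if "0 \<le> s" "s \<le> h" "0 \<le> t" "t \<le> h" for s t
    using nb[OF that] h by (simp add: dist_norm norm_minus_commute algebra_simps)
  have inb0: "x + s *\<^sub>R axis i 1 \<in> ball x e" if "0 \<le> s" "s \<le> h" for s
    using inb[OF that, of 0] h by simp
  \<comment> \<open>The first difference in direction \<open>j\<close>, as a function of the
    displacement in direction \<open>i\<close>. One mean value step in \<open>s\<close> produces
    \<open>pd f i\<close>, a second one in \<open>t\<close> produces
    \<open>pd (pd f i) j\<close>.\<close>
  define \<phi> where "\<phi> = (\<lambda>s. f (x + h *\<^sub>R axis j 1 + s *\<^sub>R axis i 1) - f (x + s *\<^sub>R axis i 1))"
  have "(\<phi> has_real_derivative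
      pd f i (x + h *\<^sub>R axis j 1 + s *\<^sub>R axis i 1) - pd f i (x + s *\<^sub>R axis i 1)) (at s)"
    if "0 \<le> s" "s \<le> h" for s
    unfolding \<phi>_def using inb[OF that, of h] inb0[OF that] h
    by (intro DERIV_diff has_real_derivative_along_axis f) (simp_all add: add_ac)
  from MVT2[OF h(1) this] obtain s where s: "0 < s" "s < h"
    "\<phi> h - \<phi> 0 = h * (pd f i (x + h *\<^sub>R axis j 1 + s *\<^sub>R axis i 1) - pd f i (x + s *\<^sub>R axis i 1))"
    by auto
  have "((\<lambda>t. pd f i (x + s *\<^sub>R axis i 1 + t *\<^sub>R axis j 1)) has_real_derivative
      pd (pd f i) j (x + s *\<^sub>R axis i 1 + t *\<^sub>R axis j 1)) (at t)"
    if "0 \<le> t" "t \<le> h" for t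
    using inb[OF _ _ that, of s] s by (intro has_real_derivative_along_axis f') simp
  from MVT2[OF h(1) this] obtain t where t: "0 < t" "t < h"
    "pd f i (x + s *\<^sub>R axis i 1 + h *\<^sub>R axis j 1) - pd f i (x + s *\<^sub>R axis i 1)
      = h * pd (pd f i) j (x + s *\<^sub>R axis i 1 + t *\<^sub>R axis j 1)"
    by auto
  show ?thesis
  proof (rule that)
    show "norm (x + s *\<^sub>R axis i 1 + t *\<^sub>R axis j 1 - x) \<le> 2 * h"
      using nb[of s t] s t by (simp add: algebra_simps)
    have "f (x + h *\<^sub>R axis i 1 + h *\<^sub>R axis j 1) - f (x + h *\<^sub>R axis i 1) - f (x + h *\<^sub>R axis j 1) + f x = \<phi> h - \<phi> 0"
      by (simp add: \<phi>_def add_ac)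
    also have "\<dots> = h * (h * pd (pd f i) j (x + s *\<^sub>R axis i 1 + t *\<^sub>R axis j 1))"
      using s(3) t(3) by (simp add: add_ac)
    finally show "f (x + h *\<^sub>R axis i 1 + h *\<^sub>R axis j 1) - f (x + h *\<^sub>R axis i 1) - f (x + h *\<^sub>R axis j 1) + f x
      = h\<^sup>2 * pd (pd f i) j (x + s *\<^sub>R axis i 1 + t *\<^sub>R axis j 1)"
      by (simp add: power2_eq_square)
  qed
qed

text \<open>The second difference is symmetric in \<open>i\<close> and \<open>j\<close>, so both
  mixed derivatives, taken at two mean value points, agree; both points tend to \<open>x\<close>,
  and continuity concludes.\<close>

lemma pd_commute:
  fixes f :: "real^'n \<Rightarrow> real"
  assumes U: "open U" "x \<in> U"
    and f: "\<And>y. y \<in> U \<Longrightarrow> f differentiable (at y)"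
    and f': "\<And>i y. y \<in> U \<Longrightarrow> pd f i differentiable (at y)"
    and f'': "\<And>i j. continuous_on U (pd (pd f i) j)"
  shows "pd (pd f i) j x = pd (pd f j) i x"
proof -
  obtain e where e: "e > 0" "ball x e \<subseteq> U"
    using U open_contains_ball by blast
  \<comment> \<open>The factor \<open>e / 3\<close> keeps \<open>2 * h m\<close> below
    \<open>e\<close>, so all points of the second difference stay in the ball.\<close>
  define h where "h = (\<lambda>m. e / 3 * inverse (real (Suc m)))"
  have h: "0 < h m" "2 * h m < e" for m
  proof -
    have "inverse (real (Suc m)) \<le> 1"
      by (simp add: field_simps)
    then have "e / 3 * inverse (real (Suc m)) \<le> e / 3 * 1"
      using e by (intro mult_left_mono) auto
    then show "0 < h m" "2 * h m < e"
      using e by (auto simp: h_def)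
  qed
  let ?\<Delta> = "\<lambda>m. f (x + h m *\<^sub>R axis i 1 + h m *\<^sub>R axis j 1) - f (x + h m *\<^sub>R axis i 1) - f (x + h m *\<^sub>R axis j 1) + f x"
  have "\<exists>y. norm (y - x) \<le> 2 * h m \<and> ?\<Delta> m = (h m)\<^sup>2 * pd (pd f i) j y" for m
    by (rule second_difference_mean_value[OF h(1)[of m] h(2)[of m], of x f i j]) (use f f' e in auto)
  then obtain y where y: "norm (y m - x) \<le> 2 * h m" "?\<Delta> m = (h m)\<^sup>2 * pd (pd f i) j (y m)" for m
    by metis
  have "\<exists>y. norm (y - x) \<le> 2 * h m \<and> ?\<Delta> m = (h m)\<^sup>2 * pd (pd f j) i y" for m
  proof -
    have \<Delta>: "?\<Delta> m = f (x + h m *\<^sub>R axis j 1 + h m *\<^sub>R axis i 1) - f (x + h m *\<^sub>R axis j 1) - f (x + h m *\<^sub>R axis i 1) + f x"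
      by (simp add: add_ac)
    show ?thesis
      unfolding \<Delta> 
    by (rule second_difference_mean_value[OF h(1)[of m] h(2)[of m], of x f j i]) (use f f' e in auto)
  qed
  then obtain z where z: "norm (z m - x) \<le> 2 * h m" "?\<Delta> m = (h m)\<^sup>2 * pd (pd f j) i (z m)" for m
    by metis
  have "h \<longlonglongrightarrow> e / 3 * 0"
    unfolding h_def by (intro tendsto_intros LIMSEQ_inverse_real_of_nat)
  then have h0: "(\<lambda>m. 2 * h m) \<longlonglongrightarrow> 0"
    using tendsto_mult_left[of h 0 sequentially 2] by simp
  have "y \<longlonglongrightarrow> x" "z \<longlonglongrightarrow> x"
    using y(1) z(1) by (auto intro!: LIM_zero_cancel Lim_null_comparison[OF _ h0])
  moreover have "isCont (pd (pd f i) j) x" "isCont (pd (pd f j) i) x"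
    using f'' U continuous_on_eq_continuous_at by blast+
  ultimately have "(\<lambda>m. pd (pd f i) j (y m)) \<longlonglongrightarrow> pd (pd f i) j x" "(\<lambda>m. pd (pd f j) i (z m)) \<longlonglongrightarrow> pd (pd f j) i x"
    using isCont_tendsto_compose by blast+
  moreover have "pd (pd f i) j (y m) = pd (pd f j) i (z m)" for m
    using y(2)[of m] z(2)[of m] h(1)[of m] by simp
  ultimately show ?thesis
    using LIMSEQ_unique by auto
qed

section \<open>The linearised Einstein tensor\<close>

definition kd :: "'n \<Rightarrow> 'n \<Rightarrow> real" where
  "kd i j = (if i = j then 1 else 0)"

lemma kd_same [simp]: "kd i i = 1"
  by (simp add: kd_def)

lemma sum_kd [simp]:
  fixes f :: "'n::finite \<Rightarrow> real"
  shows "(\<Sum>k\<in>UNIV. kd k j * f k) = f j" "(\<Sum>k\<in>UNIV. kd j k * f k) = f j"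
    "(\<Sum>k\<in>UNIV. f k * kd k j) = f j" "(\<Sum>k\<in>UNIV. f k * kd j k) = f j"
  by (simp_all add: kd_def if_distrib if_distribR cong: if_cong)

text \<open>Below, \<open>H i j k l\<close> stands for \<open>\<partial>\<^sub>l \<partial>\<^sub>k g\<^sub>i\<^sub>j\<close> at a fixed point.\<close>

definition lin_ricci :: "('n::finite \<Rightarrow> 'n \<Rightarrow> 'n \<Rightarrow> 'n \<Rightarrow> real) \<Rightarrow> 'n \<Rightarrow> 'n \<Rightarrow> real" where
  "lin_ricci H i j = 1/2 * (\<Sum>k\<in>UNIV. H k i j k + H k j i k - H i j k k - H k k i j)"

definition lin_einstein :: "('n::finite \<Rightarrow> 'n \<Rightarrow> 'n \<Rightarrow> 'n \<Rightarrow> real) \<Rightarrow> 'n \<Rightarrow> 'n \<Rightarrow> real" where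
  "lin_einstein H i j = lin_ricci H i j - 1/2 * (\<Sum>k\<in>UNIV. lin_ricci H k k) * kd i j"

text \<open>The summand is the derivative in direction \<open>k\<close> of
  \<open>superpotential\<close>, which is antisymmetric in \<open>j\<close> and \<open>k\<close>;
  this exhibits the linearised contracted Bianchi identity. The trace of \<open>W\<close> is the
  linearised scalar curvature, because \<open>H\<close> is symmetric in each index pair.\<close>

lemma lin_einstein_divergence_form:
  fixes H :: "'n::finite \<Rightarrow> 'n \<Rightarrow> 'n \<Rightarrow> 'n \<Rightarrow> real"
  assumes s1: "\<And>i j k l. H i j k l = H j i k l" and s2: "\<And>i j k l. H i j k l = H i j l k"
  defines "W \<equiv> \<lambda>j k. \<Sum>l\<in>UNIV. H j l l k - H l l j k"
  shows "(\<Sum>k\<in>UNIV. 1/2 * (H i k j k - H i j k k + kd i k * W j k - kd i j * W k k)) = lin_einstein H i j"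
proof -
  have Wji: "W j i = (\<Sum>k\<in>UNIV. H k j i k) - (\<Sum>k\<in>UNIV. H k k i j)"
  proof -
    have "H j l l i = H l j i l" "H l l j i = H l l i j" for l
      using s1[of j l] s2[of l j] s2[of l l] by simp_all
    then show ?thesis by (simp only: W_def sum_subtractf)
  qed
  have tr: "(\<Sum>k\<in>UNIV. lin_ricci H k k) = (\<Sum>k\<in>UNIV. W k k)"
  proof -
    have "(\<Sum>k\<in>UNIV. \<Sum>l\<in>UNIV. H k k l l) = (\<Sum>k\<in>UNIV. \<Sum>l\<in>UNIV. H l l k k)"
      by (rule sum.swap)
    moreover have "(\<Sum>l\<in>UNIV. H l k k l) = (\<Sum>l\<in>UNIV. H k l l k)" for k
      using s1 s2 by metis
    ultimately show ?thesis
      by (simp add: lin_ricci_def W_def sum.distrib sum_subtractf sum_divide_distrib[symmetric] flip: sum_distrib_left)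
  qed
  have ik: "(\<Sum>k\<in>UNIV. H i k j k) = (\<Sum>k\<in>UNIV. H k i j k)"
    using s1 by metis
  have "(\<Sum>k\<in>UNIV. 1/2 * (H i k j k - H i j k k + kd i k * W j k - kd i j * W k k))
      = 1/2 * ((\<Sum>k\<in>UNIV. H i k j k) - (\<Sum>k\<in>UNIV. H i j k k) + W j i - kd i j * (\<Sum>k\<in>UNIV. W k k))"
    unfolding sum_distrib_left[symmetric] by (simp only: sum.distrib sum_subtractf sum_kd sum_distrib_left[symmetric])
  also have "\<dots> = lin_einstein H i j"
    unfolding lin_einstein_def tr unfolding lin_ricci_def Wji ik
    by (simp add: sum.distrib sum_subtractf algebra_simps)
  finally show ?thesis .
qed

text \<open>The bracket is \<open>d_k Y_i\<close>, so this is the Leibniz term left after moving the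
  divergence past \<open>Y\<close>. Its pure trace part, \<open>-2 x_a kd i k\<close>, meets the
  trace of \<open>B\<close>, which is (n - 2)/2 times \<open>V j\<close>, and yields the leading
  term of \<open>c_CS\<close>; the rotational part of the gradient leaves the other first-order
  terms.\<close>

lemma superpotential_contract_Yfield:
  fixes d :: "'n::finite \<Rightarrow> 'n \<Rightarrow> 'n \<Rightarrow> real" and x :: "'n \<Rightarrow> real"
  assumes s1: "\<And>i j k. d i j k = d j i k"
  defines "V \<equiv> \<lambda>j. \<Sum>l\<in>UNIV. d j l l - d l l j"
  defines "B \<equiv> \<lambda>i j k. 1/2 * (d i k j - d i j k + kd i k * V j - kd i j * V k)"
  shows "(\<Sum>i\<in>UNIV. \<Sum>k\<in>UNIV. B i j k * (2 * x k * kd a i - 2 * kd a k * x i - 2 * x a * kd i k))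
     = - (real CARD('n) - 2) * x a * V j
       - kd a j * (\<Sum>k\<in>UNIV. x k * V k) + x j * V a - (\<Sum>k\<in>UNIV. x k * d a j k) + (\<Sum>i\<in>UNIV. x i * d i j a)"
proof -
  have 1: "(\<Sum>k\<in>UNIV. B i j k * (2 * x k * kd a i - 2 * kd a k * x i - 2 * x a * kd i k))
    = 2 * (kd a i * (\<Sum>k\<in>UNIV. B i j k * x k)) - 2 * (B i j a * x i) - 2 * (x a * B i j i)" for i
  proof -
    have "(\<Sum>k\<in>UNIV. B i j k * (2 * x k * kd a i - 2 * kd a k * x i - 2 * x a * kd i k))
      = (\<Sum>k\<in>UNIV. 2 * kd a i * (B i j k * x k) - 2 * x i * (B i j k * kd a k) - 2 * x a * (B i j k * kd i k))"
      by (rule sum.cong) (auto simp: algebra_simps)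
    also have "\<dots> = 2 * kd a i * (\<Sum>k\<in>UNIV. B i j k * x k) - 2 * x i * B i j a - 2 * x a * B i j i"
      by (simp only: sum_subtractf sum_distrib_left[symmetric] sum_kd)
    finally show ?thesis by simp
  qed
  have 2: "(\<Sum>i\<in>UNIV. \<Sum>k\<in>UNIV. B i j k * (2 * x k * kd a i - 2 * kd a k * x i - 2 * x a * kd i k))
    = 2 * (\<Sum>k\<in>UNIV. B a j k * x k) - 2 * (\<Sum>i\<in>UNIV. B i j a * x i) - 2 * x a * (\<Sum>i\<in>UNIV. B i j i)"
    unfolding 1 by (simp add: sum_subtractf flip: sum_distrib_left)
  have b1: "2 * (\<Sum>k\<in>UNIV. B a j k * x k) = (\<Sum>k\<in>UNIV. d a k j * x k) - (\<Sum>k\<in>UNIV. x k * d a j k) + x a * V j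
      - kd a j * (\<Sum>k\<in>UNIV. x k * V k)"
  proof -
    have "2 * (\<Sum>k\<in>UNIV. B a j k * x k) = (\<Sum>k\<in>UNIV. d a k j * x k - x k * d a j k + kd a k * (x k * V j) - kd a j * (x k * V k))"
      unfolding sum_distrib_left by (rule sum.cong) (auto simp: B_def algebra_simps)
    then show ?thesis by (simp only: sum.distrib sum_subtractf sum_kd sum_distrib_left[symmetric])
  qed
  have b2: "2 * (\<Sum>i\<in>UNIV. B i j a * x i) = (\<Sum>i\<in>UNIV. d a i j * x i) - (\<Sum>i\<in>UNIV. x i * d i j a) + x a * V j - x j * V a"
  proof -
    have "2 * (\<Sum>i\<in>UNIV. B i j a * x i) = (\<Sum>i\<in>UNIV. d a i j * x i - x i * d i j a + kd i a * (x i * V j) - kd i j * (x i * V a))"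
      unfolding sum_distrib_left by (rule sum.cong) (auto simp: B_def algebra_simps s1[of a])
    then show ?thesis by (simp only: sum.distrib sum_subtractf sum_kd)
  qed
  have b3: "2 * (\<Sum>i\<in>UNIV. B i j i) = (real CARD('n) - 2) * V j"
  proof -
    have "2 * (\<Sum>i\<in>UNIV. B i j i) = (\<Sum>i\<in>UNIV. d i i j - d i j i + V j - kd i j * V i)"
      unfolding sum_distrib_left by (rule sum.cong) (auto simp: B_def algebra_simps)
    also have "\<dots> = - V j + real CARD('n) * V j - V j"
      by (simp add: sum.distrib sum_subtractf V_def s1[of j])
    finally show ?thesis by (simp add: algebra_simps)
  qed
  have "2 * x a * (\<Sum>i\<in>UNIV. B i j i) = x a * ((real CARD('n) - 2) * V j)"
    by (simp flip: b3)
  then show ?thesis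
    unfolding 2 b1 b2 by (simp add: algebra_simps)
qed

text \<open>\<open>C j k m\<close> is the product-rule expansion of
  \<open>pd (correction g a j k) m\<close>, so only algebra in \<open>g\<close> and \<open>d\<close>
  remains. The factor \<open>n - 2\<close> comes from traces of Kronecker deltas: summing
  \<open>kd k k\<close> gives \<open>n\<close>, and two single deltas remove 2.\<close>

lemma correction_divergence:
  fixes g :: "'n::finite \<Rightarrow> 'n \<Rightarrow> real" and d :: "'n::finite \<Rightarrow> 'n \<Rightarrow> 'n \<Rightarrow> real" and x :: "'n \<Rightarrow> real" and a :: 'n
  assumes s0: "\<And>i j. g i j = g j i" and s1: "\<And>i j k. d i j k = d j i k"
  defines "V \<equiv> \<lambda>j. \<Sum>l\<in>UNIV. d j l l - d l l j"
  defines "C \<equiv> \<lambda>j k m. - (kd j m * g a k + x j * d a k m - (kd k m * g a j + x k * d a j m))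
      + (kd a j * (\<Sum>i\<in>UNIV. kd i m * g i k + x i * d i k m) - kd a k * (\<Sum>i\<in>UNIV. kd i m * g i j + x i * d i j m))
      + ((\<Sum>l\<in>UNIV. d l l m) * (x j * kd a k - x k * kd a j) + (\<Sum>l\<in>UNIV. g l l) * (kd j m * kd a k - kd k m * kd a j))"
  shows "(\<Sum>k\<in>UNIV. C j k k) = (real CARD('n) - 2) * (g j a - (\<Sum>l\<in>UNIV. g l l) * kd a j)
     + kd a j * (\<Sum>k\<in>UNIV. x k * V k) - x j * V a + (\<Sum>k\<in>UNIV. x k * d a j k) - (\<Sum>i\<in>UNIV. x i * d i j a)"
proof -
  define P where "P = (\<lambda>k. kd j k * g a k + x j * d a k k - (kd k k * g a j + x k * d a j k))"
  define Q where "Q = (\<lambda>k. kd a j * (\<Sum>i\<in>UNIV. kd i k * g i k + x i * d i k k) - kd a k * (\<Sum>i\<in>UNIV. kd i k * g i j + x i * d i j k))"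
  define R where "R = (\<lambda>k. (\<Sum>l\<in>UNIV. d l l k) * (x j * kd a k - x k * kd a j) + (\<Sum>l\<in>UNIV. g l l) * (kd j k * kd a k - kd k k * kd a j))"
  have c1: "sum P UNIV
    = g a j + x j * (\<Sum>k\<in>UNIV. d a k k) - real CARD('n) * g a j - (\<Sum>k\<in>UNIV. x k * d a j k)"
    by (simp add: P_def sum.distrib sum_subtractf sum_distrib_left)
  have c2: "sum Q UNIV
    = kd a j * ((\<Sum>k\<in>UNIV. g k k) + (\<Sum>k\<in>UNIV. \<Sum>i\<in>UNIV. x i * d i k k)) - (g a j + (\<Sum>i\<in>UNIV. x i * d i j a))"
    by (simp add: Q_def sum.distrib sum_subtractf flip: sum_distrib_left)
  have c3: "sum R UNIV
    = x j * (\<Sum>l\<in>UNIV. d l l a) - kd a j * (\<Sum>k\<in>UNIV. x k * (\<Sum>l\<in>UNIV. d l l k)) + (\<Sum>l\<in>UNIV. g l l) * (kd a j - real CARD('n) * kd a j)"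
  proof -
    have "sum R UNIV
      = (\<Sum>k\<in>UNIV. x j * (kd a k * (\<Sum>l\<in>UNIV. d l l k)) - kd a j * (x k * (\<Sum>l\<in>UNIV. d l l k))
          + (\<Sum>l\<in>UNIV. g l l) * (kd j k * kd a k - kd a j))"
      by (rule sum.cong) (auto simp: R_def algebra_simps)
    also have "\<dots> = x j * (\<Sum>l\<in>UNIV. d l l a) - kd a j * (\<Sum>k\<in>UNIV. x k * (\<Sum>l\<in>UNIV. d l l k))
        + (\<Sum>l\<in>UNIV. g l l) * (kd a j - real CARD('n) * kd a j)"
      by (simp only: sum.distrib sum_subtractf sum_distrib_left[symmetric] sum_kd) simp
    finally show ?thesis .
  qed
  have xV: "(\<Sum>k\<in>UNIV. x k * V k) = (\<Sum>k\<in>UNIV. \<Sum>i\<in>UNIV. x i * d i k k) - (\<Sum>k\<in>UNIV. x k * (\<Sum>l\<in>UNIV. d l l k))"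
  proof -
    have "(\<Sum>k\<in>UNIV. x k * V k) = (\<Sum>k\<in>UNIV. \<Sum>i\<in>UNIV. x k * d k i i) - (\<Sum>k\<in>UNIV. x k * (\<Sum>l\<in>UNIV. d l l k))"
      by (simp add: V_def sum_subtractf right_diff_distrib sum_distrib_left)
    then show ?thesis
      using sum.swap[of "\<lambda>k i. x k * d k i i" UNIV UNIV] by simp
  qed
  have xVa: "x j * V a = x j * (\<Sum>k\<in>UNIV. d a k k) - x j * (\<Sum>l\<in>UNIV. d l l a)"
    by (simp add: V_def sum_subtractf right_diff_distrib)
  have C: "C j k k = - P k + Q k + R k" for k
    by (simp add: C_def P_def Q_def R_def)
  show ?thesis
    unfolding C sum.distrib sum_negf c1 c2 c3 xV xVa s0[of j a]
    by (simp add: algebra_simps)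
qed

text \<open>The vector field whose flux defines the ADM mass; its divergence is the linearised
  scalar curvature.\<close>

definition trace_vec :: "('n::finite \<Rightarrow> 'n \<Rightarrow> real^'n \<Rightarrow> real) \<Rightarrow> 'n \<Rightarrow> real^'n \<Rightarrow> real" where
  "trace_vec g j x = (\<Sum>l\<in>UNIV. pd (g j l) l x - pd (g l l) j x)"

definition superpotential :: "('n::finite \<Rightarrow> 'n \<Rightarrow> real^'n \<Rightarrow> real) \<Rightarrow> 'n \<Rightarrow> 'n \<Rightarrow> 'n \<Rightarrow> real^'n \<Rightarrow> real" where
  "superpotential g i j k x = 1/2 * (pd (g i k) j x - pd (g i j) k x + kd i k * trace_vec g j x - kd i j * trace_vec g k x)"

text \<open>
  Its divergence produces the undifferentiated terms of the \<open>c_CS\<close> integrand and cancels the first-order terms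
  left over in \<open>superpotential_contract_Yfield\<close>.
\<close>

definition correction :: "('n::finite \<Rightarrow> 'n \<Rightarrow> real^'n \<Rightarrow> real) \<Rightarrow> 'n \<Rightarrow> 'n \<Rightarrow> 'n \<Rightarrow> real^'n \<Rightarrow> real" where
  "correction g a j k x = - (x$j * g a k x - x$k * g a j x)
     + (kd a j * (\<Sum>i\<in>UNIV. x$i * g i k x) - kd a k * (\<Sum>i\<in>UNIV. x$i * g i j x))
     + (\<Sum>l\<in>UNIV. g l l x) * (x$j * kd a k - x$k * kd a j)"

definition antisym_potential :: "('n::finite \<Rightarrow> 'n \<Rightarrow> real^'n \<Rightarrow> real) \<Rightarrow> 'n \<Rightarrow> 'n \<Rightarrow> 'n \<Rightarrow> real^'n \<Rightarrow> real" where
  "antisym_potential g a j k x = (\<Sum>i\<in>UNIV. superpotential g i j k x * Yfield a x $ i) + correction g a j k x"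

lemma differentiable_sumI:
  fixes f :: "'k \<Rightarrow> 'a::real_normed_vector \<Rightarrow> 'b::real_normed_vector"
  shows "(\<And>i. i \<in> I \<Longrightarrow> f i differentiable F) \<Longrightarrow> (\<lambda>x. \<Sum>i\<in>I. f i x) differentiable F"
  by (cases "finite I") auto

lemmas differentiable_intros = differentiable_add differentiable_diff differentiable_minus differentiable_mult
  differentiable_sumI differentiable_const differentiable_component

text \<open>Writing the squared norm as a sum of squares makes the components polynomials, hence
  differentiable and continuous by the standard rules.\<close>

lemma Yfield_component: "Yfield a x $ i = (\<Sum>l\<in>UNIV. x$l * x$l) * kd a i - 2 * x$a * x$i"
  by (simp add: Yfield_def kd_def power2_norm_eq_inner inner_vec_def)

lemma differentiable_Yfield: "(\<lambda>x. Yfield a x $ i) differentiable (at x)"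
  unfolding Yfield_component
  by (intro differentiable_intros)

lemma pd_Yfield: "pd (\<lambda>x. Yfield a x $ i) m x = 2 * x$m * kd a i - 2 * kd a m * x$i - 2 * x$a * kd i m"
proof -
  have "(if l = m then 1 else 0) = kd l m" for l by (simp add: kd_def)
  moreover have "(\<Sum>l\<in>UNIV. 2 * (x $ l * kd l m)) = 2 * x $ m"
    by (simp flip: sum_distrib_left)
  ultimately show ?thesis
    unfolding Yfield_component
    by (simp add: pd_diff pd_mult pd_sum pd_component differentiable_intros sum.distrib)
qed

lemma pd_minus: "pd (\<lambda>x. - f x) i x = - pd f i x" if "f differentiable (at x)"
  using pd_cmult[OF that, of "-1"] by simp

lemma antisym_potential_commute: "antisym_potential g a k j = (\<lambda>x. - antisym_potential g a j k x)"
proof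
  fix x
  have "superpotential g i k j x = - superpotential g i j k x" for i
    by (simp add: superpotential_def algebra_simps)
  moreover have "correction g a k j x = - correction g a j k x"
    by (simp add: correction_def algebra_simps)
  ultimately show "antisym_potential g a k j x = - antisym_potential g a j k x"
    by (simp add: antisym_potential_def sum_negf)
qed

context
  fixes g :: "'n::finite \<Rightarrow> 'n \<Rightarrow> real^'n \<Rightarrow> real" and U :: "(real^'n) set" and a :: 'n
  assumes U: "open U"
    and sym: "\<And>i j x. x \<in> U \<Longrightarrow> g i j x = g j i x"
    and d1: "\<And>i j x. x \<in> U \<Longrightarrow> g i j differentiable (at x)"
    and d2: "\<And>i j k x. x \<in> U \<Longrightarrow> pd (g i j) k differentiable (at x)"
    and c2: "\<And>i j k l. continuous_on U (pd (pd (g i j) k) l)"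
begin

private lemma diff_superpotential: "x \<in> U \<Longrightarrow> superpotential g i j k differentiable (at x)"
  unfolding superpotential_def trace_vec_def
  by (intro differentiable_intros d2)

private lemma pd_superpotential:
  assumes x: "x \<in> U"
  defines "W \<equiv> \<lambda>j k. \<Sum>l\<in>UNIV. pd (pd (g j l) l) k x - pd (pd (g l l) j) k x"
  shows "pd (superpotential g i j k) m x
    = 1/2 * (pd (pd (g i k) j) m x - pd (pd (g i j) k) m x + kd i k * W j m - kd i j * W k m)"
proof -
  have dV: "trace_vec g j differentiable (at x)" for j
    unfolding trace_vec_def by (intro differentiable_intros d2 x)
  have V: "pd (trace_vec g j) k x = W j k" for j k
    unfolding trace_vec_def W_def by (simp add: pd_sum pd_diff d2 x differentiable_intros)
  show ?thesis
    unfolding superpotential_def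
    by (subst pd_cmult) (simp_all add: pd_mult pd_add pd_diff d2 x dV V differentiable_intros)
qed

private lemma diff_correction: "x \<in> U \<Longrightarrow> correction g a j k differentiable (at x)"
  unfolding correction_def
  by (intro differentiable_intros d1)

private lemma pd_correction:
  assumes x: "x \<in> U"
  shows "pd (correction g a j k) m x = - (kd j m * g a k x + x$j * pd (g a k) m x - (kd k m * g a j x + x$k * pd (g a j) m x))
      + (kd a j * (\<Sum>i\<in>UNIV. kd i m * g i k x + x$i * pd (g i k) m x) - kd a k * (\<Sum>i\<in>UNIV. kd i m * g i j x + x$i * pd (g i j) m x))
      + ((\<Sum>l\<in>UNIV. pd (g l l) m x) * (x$j * kd a k - x$k * kd a j) + (\<Sum>l\<in>UNIV. g l l x) * (kd j m * kd a k - kd k m * kd a j))"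
proof -
  have "(if l = m then 1 else 0) = kd l m" for l by (simp add: kd_def)
  then show ?thesis
    unfolding correction_def
    by (simp add: pd_minus pd_add pd_diff pd_mult pd_sum pd_component d1 x differentiable_intros)
qed

private lemma diff_antisym_potential: "x \<in> U \<Longrightarrow> antisym_potential g a j k differentiable (at x)"
  unfolding antisym_potential_def
  by (intro differentiable_intros differentiable_Yfield diff_superpotential diff_correction)

private lemma pd_antisym_potential:
  assumes x: "x \<in> U"
  shows "pd (antisym_potential g a j k) m x = (\<Sum>i\<in>UNIV. pd (superpotential g i j k) m x * Yfield a x $ i
      + superpotential g i j k x * (2 * x$m * kd a i - 2 * kd a m * x$i - 2 * x$a * kd i m)) + pd (correction g a j k) m x"
  unfolding antisym_potential_def
  by (simp add: pd_add pd_sum pd_mult pd_Yfield differentiable_Yfield diff_superpotential diff_correction x differentiable_intros)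

private lemma c1: "continuous_on U (pd (g i j) k)"
  using U d2 by (intro continuous_at_imp_continuous_on ballI differentiable_imp_continuous_within) auto

private lemma c0: "continuous_on U (g i j)"
  using U d1 by (intro continuous_at_imp_continuous_on ballI differentiable_imp_continuous_within) auto

text \<open>The potential contains first derivatives of \<open>g\<close>, so its derivatives involve
  second ones; a \<open>C^2\<close> metric supplies exactly the continuity that the rotation
  argument asks for.\<close>

private lemma continuous_pd_antisym_potential: "continuous_on U (pd (antisym_potential g a j k) m)"
proof -
  have "continuous_on U (\<lambda>x. (\<Sum>i\<in>UNIV. 1/2 * (pd (pd (g i k) j) m x - pd (pd (g i j) k) m x
        + kd i k * (\<Sum>l\<in>UNIV. pd (pd (g j l) l) m x - pd (pd (g l l) j) m x)
        - kd i j * (\<Sum>l\<in>UNIV. pd (pd (g k l) l) m x - pd (pd (g l l) k) m x)) * Yfield a x $ i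
      + superpotential g i j k x * (2 * x$m * kd a i - 2 * kd a m * x$i - 2 * x$a * kd i m))
      + (- (kd j m * g a k x + x$j * pd (g a k) m x - (kd k m * g a j x + x$k * pd (g a j) m x))
      + (kd a j * (\<Sum>i\<in>UNIV. kd i m * g i k x + x$i * pd (g i k) m x) - kd a k * (\<Sum>i\<in>UNIV. kd i m * g i j x + x$i * pd (g i j) m x))
      + ((\<Sum>l\<in>UNIV. pd (g l l) m x) * (x$j * kd a k - x$k * kd a j) + (\<Sum>l\<in>UNIV. g l l x) * (kd j m * kd a k - kd k m * kd a j))))"
    unfolding Yfield_component superpotential_def trace_vec_def
    by (intro continuous_intros c0 c1 c2)
  then show ?thesis
    by (rule continuous_on_cong[THEN iffD1, rotated -1])
       (simp_all add: pd_antisym_potential pd_superpotential pd_correction)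
qed

text \<open>The Leibniz rule gives three sums: the divergence of the superpotential is the
  linearised Einstein tensor, and the first-order leftovers of the contraction with the gradient of
  \<open>Y\<close> cancel against those of \<open>correction\<close>.\<close>

private lemma divergence_antisym_potential:
  assumes x: "x \<in> U"
  shows "(\<Sum>k\<in>UNIV. pd (antisym_potential g a j k) k x)
    = (\<Sum>i\<in>UNIV. lin_einstein (\<lambda>i j k l. pd (pd (g i j) k) l x) i j * Yfield a x $ i)
      - (real CARD('n) - 2) * (x$a * trace_vec g j x - (g j a x - (\<Sum>l\<in>UNIV. g l l x) * kd a j))"
proof -
  have s1: "pd (g i j) k y = pd (g j i) k y" if "y \<in> U" for i j k y
    by (rule pd_cong[OF U that]) (simp add: sym)
  have s2: "pd (pd (g i j) k) l x = pd (pd (g j i) k) l x" for i j k l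
    by (rule pd_cong[OF U x]) (simp add: s1)
  have s3: "pd (pd (g i j) k) l x = pd (pd (g i j) l) k x" for i j k l
    by (rule pd_commute[OF U x d1 d2 c2])
  have "(\<Sum>k\<in>UNIV. pd (antisym_potential g a j k) k x)
    = (\<Sum>k\<in>UNIV. \<Sum>i\<in>UNIV. pd (superpotential g i j k) k x * Yfield a x $ i)
      + (\<Sum>k\<in>UNIV. \<Sum>i\<in>UNIV. superpotential g i j k x * (2 * x$k * kd a i - 2 * kd a k * x$i - 2 * x$a * kd i k))
      + (\<Sum>k\<in>UNIV. pd (correction g a j k) k x)"
    by (simp only: pd_antisym_potential[OF x] sum.distrib)
  also have "(\<Sum>k\<in>UNIV. \<Sum>i\<in>UNIV. pd (superpotential g i j k) k x * Yfield a x $ i)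
    = (\<Sum>i\<in>UNIV. (\<Sum>k\<in>UNIV. pd (superpotential g i j k) k x) * Yfield a x $ i)"
    by (subst sum.swap) (simp add: sum_distrib_right)
  also have "\<dots> = (\<Sum>i\<in>UNIV. lin_einstein (\<lambda>i j k l. pd (pd (g i j) k) l x) i j * Yfield a x $ i)"
    unfolding pd_superpotential[OF x]
    by (subst lin_einstein_divergence_form[of "\<lambda>i j k l. pd (pd (g i j) k) l x", OF s2 s3]) (rule refl)
  also have "(\<Sum>k\<in>UNIV. \<Sum>i\<in>UNIV. superpotential g i j k x * (2 * x$k * kd a i - 2 * kd a k * x$i - 2 * x$a * kd i k))
    = (\<Sum>i\<in>UNIV. \<Sum>k\<in>UNIV. superpotential g i j k x * (2 * x$k * kd a i - 2 * kd a k * x$i - 2 * x$a * kd i k))"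
    by (rule sum.swap)
  also have "\<dots> = - (real CARD('n) - 2) * x$a * trace_vec g j x
       - kd a j * (\<Sum>k\<in>UNIV. x$k * trace_vec g k x) + x$j * trace_vec g a x - (\<Sum>k\<in>UNIV. x$k * pd (g a j) k x) + (\<Sum>i\<in>UNIV. x$i * pd (g i j) a x)"
    using superpotential_contract_Yfield[of "\<lambda>i j k. pd (g i j) k x" j "\<lambda>i. x$i" a, OF s1[OF x]]
    unfolding superpotential_def trace_vec_def .
  also have "(\<Sum>k\<in>UNIV. pd (correction g a j k) k x) = (real CARD('n) - 2) * (g j a x - (\<Sum>l\<in>UNIV. g l l x) * kd a j)
     + kd a j * (\<Sum>k\<in>UNIV. x$k * trace_vec g k x) - x$j * trace_vec g a x + (\<Sum>k\<in>UNIV. x$k * pd (g a j) k x) - (\<Sum>i\<in>UNIV. x$i * pd (g i j) a x)"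
    using correction_divergence[of "\<lambda>i j. g i j x" "\<lambda>i j k. pd (g i j) k x" j a "\<lambda>i. x$i", OF sym[OF x] s1[OF x]]
    unfolding pd_correction[OF x] trace_vec_def .
  finally show ?thesis
    by (simp add: algebra_simps)
qed

lemma sphere_int_lin_einstein:
  assumes r: "r > 0" and S: "sphere 0 r \<subseteq> U"
  shows "sphere_int r (\<lambda>x. (\<Sum>j\<in>UNIV. \<Sum>i\<in>UNIV. lin_einstein (\<lambda>i j k l. pd (pd (g i j) k) l x) i j * Yfield a x $ i * nu_e x $ j)
     - (real CARD('n) - 2) * ((\<Sum>i\<in>UNIV. \<Sum>j\<in>UNIV. x$a * (pd (g i j) i x - pd (g i i) j x) * nu_e x $ j)
        - ((\<Sum>i\<in>UNIV. g i a x * nu_e x $ i) - (\<Sum>i\<in>UNIV. g i i x) * nu_e x $ a))) = 0" (is "sphere_int r ?F = 0")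
proof -
  have S': "x \<in> U" if "norm x = r" for x
    using S that by auto
  have "sphere_int r (\<lambda>x. \<Sum>j\<in>UNIV. \<Sum>k\<in>UNIV. x$j * pd (antisym_potential g a j k) k x) = 0"
  proof (rule sphere_int_divergence_antisym[OF r])
    show "continuous_on (sphere 0 r) (pd (antisym_potential g a j k) i)" for j k i
      using continuous_on_subset[OF continuous_pd_antisym_potential S] .
    show "pd (antisym_potential g a k j) i x = - pd (antisym_potential g a j k) i x" if "norm x = r" for j k i x
      unfolding antisym_potential_commute[of g a k j] by (rule pd_minus[OF diff_antisym_potential[OF S'[OF that]]])
  qed (rule diff_antisym_potential[OF S'])
  moreover have eq: "(\<Sum>j\<in>UNIV. \<Sum>k\<in>UNIV. x$j * pd (antisym_potential g a j k) k x) = r * ?F x" if x: "norm x = r" for x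
  proof -
    \<comment> \<open>The rotation fields carry the unnormalised \<open>x_j\<close>; on the sphere
      this costs a factor \<open>r\<close>, divided out at the end.\<close>
    have nu: "x$j = r * nu_e x $ j" for j
      using x r by (simp add: nu_e_def)
    have s1: "pd (g i j) k x = pd (g j i) k x" for i j k
      by (rule pd_cong[OF U S'[OF x]]) (simp add: sym)
    let ?E = "\<lambda>i j. lin_einstein (\<lambda>i j k l. pd (pd (g i j) k) l x) i j"
    have "(\<Sum>j\<in>UNIV. \<Sum>k\<in>UNIV. x$j * pd (antisym_potential g a j k) k x)
      = (\<Sum>j\<in>UNIV. r * nu_e x $ j * ((\<Sum>i\<in>UNIV. ?E i j * Yfield a x $ i)
         - (real CARD('n) - 2) * (x$a * trace_vec g j x - (g j a x - (\<Sum>l\<in>UNIV. g l l x) * kd a j))))"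
      unfolding sum_distrib_left[symmetric] divergence_antisym_potential[OF S'[OF x]] by (simp only: nu)
    also have "\<dots> = r * ((\<Sum>j\<in>UNIV. \<Sum>i\<in>UNIV. ?E i j * Yfield a x $ i * nu_e x $ j)
       - (real CARD('n) - 2) * ((\<Sum>j\<in>UNIV. x$a * trace_vec g j x * nu_e x $ j)
          - ((\<Sum>j\<in>UNIV. g j a x * nu_e x $ j) - (\<Sum>l\<in>UNIV. g l l x) * (\<Sum>j\<in>UNIV. kd a j * nu_e x $ j))))"
    proof -
      define S where "S = (\<lambda>j. \<Sum>i\<in>UNIV. ?E i j * Yfield a x $ i)"
      have S: "(\<Sum>j\<in>UNIV. \<Sum>i\<in>UNIV. ?E i j * Yfield a x $ i * nu_e x $ j) = (\<Sum>j\<in>UNIV. S j * nu_e x $ j)"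
        by (simp only: S_def sum_distrib_right)
      have S': "(\<Sum>i\<in>UNIV. ?E i j * Yfield a x $ i) = S j" for j
        by (simp only: S_def)
      show ?thesis
        unfolding S S' sum_distrib_left sum_subtractf[symmetric]
        by (rule sum.cong) (simp_all add: algebra_simps)
    qed
    also have "(\<Sum>j\<in>UNIV. kd a j * nu_e x $ j) = nu_e x $ a"
      by simp
    also have "(\<Sum>j\<in>UNIV. x$a * trace_vec g j x * nu_e x $ j) = (\<Sum>i\<in>UNIV. \<Sum>j\<in>UNIV. x$a * (pd (g i j) i x - pd (g i i) j x) * nu_e x $ j)"
    proof -
      have "x$a * trace_vec g j x * nu_e x $ j = (\<Sum>i\<in>UNIV. x$a * (pd (g i j) i x - pd (g i i) j x) * nu_e x $ j)" for j
        unfolding trace_vec_def sum_distrib_left sum_distrib_right by (simp only: s1[of j])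
      then have "(\<Sum>j\<in>UNIV. x$a * trace_vec g j x * nu_e x $ j)
        = (\<Sum>j\<in>UNIV. \<Sum>i\<in>UNIV. x$a * (pd (g i j) i x - pd (g i i) j x) * nu_e x $ j)"
        by (rule sum.cong[OF refl])
      also have "\<dots> = (\<Sum>i\<in>UNIV. \<Sum>j\<in>UNIV. x$a * (pd (g i j) i x - pd (g i i) j x) * nu_e x $ j)"
        by (rule sum.swap)
      finally show ?thesis .
    qed
    finally show ?thesis .
  qed
  moreover have "sphere_int r (\<lambda>x. \<Sum>j\<in>UNIV. \<Sum>k\<in>UNIV. x$j * pd (antisym_potential g a j k) k x) = sphere_int r (\<lambda>x. r * ?F x)"
    by (rule sphere_int_cong[OF r eq])
  ultimately have "r * sphere_int r ?F = 0"
    by (simp only: sphere_int_cmult)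
  then show ?thesis
    using r by simp
qed

end

section \<open>Decay with parity\<close>

lemma filterlim_uminus_at_infinity: "filterlim uminus at_infinity (at_infinity :: 'a::real_normed_vector filter)"
  unfolding filterlim_at_infinity_conv_norm_at_top by (simp add: filterlim_norm_at_top)

lemma tendsto_reflect:
  assumes "((f :: 'a::real_normed_vector \<Rightarrow> 'b::topological_space) \<longlongrightarrow> l) at_infinity"
  shows "((\<lambda>x. f (- x)) \<longlongrightarrow> l) at_infinity"
  using filterlim_compose[OF assms filterlim_uminus_at_infinity] .

lemma eventually_norm_gt: "eventually (\<lambda>x::'a::real_normed_vector. R < norm x) at_infinity"
  unfolding eventually_at_infinity by (intro exI[of _ "R + 1"]) auto

lemma powr_decay_mono:
  fixes f :: "'a::real_normed_vector \<Rightarrow> real"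
  assumes "((\<lambda>x. norm x powr p * f x) \<longlongrightarrow> 0) at_infinity" "q \<le> p"
  shows "((\<lambda>x. norm x powr q * f x) \<longlongrightarrow> 0) at_infinity"
proof (rule Lim_null_comparison)
  show "\<forall>\<^sub>F x in at_infinity. norm (norm x powr q * f x) \<le> \<bar>norm x powr p * f x\<bar>"
    using eventually_norm_gt[of 1]
  proof eventually_elim
    case (elim x)
    then have "norm x powr q \<le> norm x powr p"
      using assms(2) by (intro powr_mono) auto
    then show ?case
      by (simp add: abs_mult mult_right_mono)
  qed
  show "((\<lambda>x. \<bar>norm x powr p * f x\<bar>) \<longlongrightarrow> 0) at_infinity"
    using assms(1) tendsto_rabs_zero by blast
qed

text \<open>\<open>s = 1\<close> stands for even and \<open>s = -1\<close> for odd. The expression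
  \<open>f x - s * f (- x)\<close> is twice the part of the wrong parity, which must decay one power
  faster than \<open>f\<close> itself.\<close>

definition parity_decay :: "real \<Rightarrow> real \<Rightarrow> ('a::real_normed_vector \<Rightarrow> real) \<Rightarrow> bool" where
  "parity_decay s p f \<longleftrightarrow> (\<exists>R. continuous_on {x. R < norm x} f)
     \<and> ((\<lambda>x. norm x powr p * f x) \<longlongrightarrow> 0) at_infinity
     \<and> ((\<lambda>x. norm x powr (p + 1) * (f x - s * f (- x))) \<longlongrightarrow> 0) at_infinity"

lemma continuous_near_infinity_combine:
  assumes "\<exists>R. continuous_on {x::'a::real_normed_vector. R < norm x} f" "\<exists>R. continuous_on {x. R < norm x} g"
  obtains R where "continuous_on {x. R < norm x} f" "continuous_on {x. R < norm x} g"
proof -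
  obtain R R' where "continuous_on {x. R < norm x} f" "continuous_on {x. R' < norm x} g"
    using assms by blast
  then show ?thesis
    by (intro that[of "max R R'"]) (auto elim: continuous_on_subset)
qed

lemma parity_decay_0 [simp]: "parity_decay s p (\<lambda>_. 0)"
  by (auto simp: parity_decay_def)

lemma parity_decay_add:
  assumes "parity_decay s p f" "parity_decay s p g"
  shows "parity_decay s p (\<lambda>x. f x + g x)"
proof -
  obtain R where "continuous_on {x. R < norm x} f" "continuous_on {x. R < norm x} g"
    using assms continuous_near_infinity_combine unfolding parity_decay_def by blast
  then have c: "continuous_on {x. R < norm x} (\<lambda>x. f x + g x)"
    by (intro continuous_intros)
  have "((\<lambda>x. norm x powr p * f x + norm x powr p * g x) \<longlongrightarrow> 0 + 0) at_infinity"
    "((\<lambda>x. norm x powr (p + 1) * (f x - s * f (- x)) + norm x powr (p + 1) * (g x - s * g (- x))) \<longlongrightarrow> 0 + 0) at_infinity"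
    using assms unfolding parity_decay_def by (intro tendsto_add; blast)+
  then have "((\<lambda>x. norm x powr p * (f x + g x)) \<longlongrightarrow> 0) at_infinity"
    "((\<lambda>x. norm x powr (p + 1) * (f x + g x - s * (f (- x) + g (- x)))) \<longlongrightarrow> 0) at_infinity"
    by (simp_all add: algebra_simps)
  then show ?thesis
    unfolding parity_decay_def using c by blast
qed

lemma parity_decay_mult:
  assumes "parity_decay s p f" "parity_decay t q g"
  shows "parity_decay (s * t) (p + q) (\<lambda>x. f x * g x)"
proof -
  obtain R where "continuous_on {x. R < norm x} f" "continuous_on {x. R < norm x} g"
    using assms continuous_near_infinity_combine unfolding parity_decay_def by blast
  then have c: "continuous_on {x. R < norm x} (\<lambda>x. f x * g x)"
    by (intro continuous_intros)
  have f: "((\<lambda>x. norm x powr p * f x) \<longlongrightarrow> 0) at_infinity"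
    "((\<lambda>x. norm x powr (p + 1) * (f x - s * f (- x))) \<longlongrightarrow> 0) at_infinity"
    and g: "((\<lambda>x. norm x powr q * g x) \<longlongrightarrow> 0) at_infinity"
    "((\<lambda>x. norm x powr (q + 1) * (g x - t * g (- x))) \<longlongrightarrow> 0) at_infinity"
    using assms by (auto simp: parity_decay_def)
  have g': "((\<lambda>x. norm x powr q * g (- x)) \<longlongrightarrow> 0) at_infinity"
    using tendsto_reflect[OF g(1)] by simp
  have "((\<lambda>x. norm x powr (p + q) * (f x * g x)) \<longlongrightarrow> 0) at_infinity"
    using tendsto_mult[OF f(1) g(1)] by (simp add: powr_add mult_ac)
  \<comment> \<open>The wrong-parity part of a product splits as
    \<open>f (g - t g') + t g' (f - s f')\<close>, primes denoting reflection; in each summand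
    exactly one factor carries the extra power.\<close>
  moreover have "((\<lambda>x. (norm x powr p * f x) * (norm x powr (q + 1) * (g x - t * g (- x)))
      + t * ((norm x powr q * g (- x)) * (norm x powr (p + 1) * (f x - s * f (- x))))) \<longlongrightarrow> 0 * 0 + t * (0 * 0)) at_infinity"
    by (intro tendsto_intros f g g')
  then have "((\<lambda>x. norm x powr (p + q + 1) * (f x * g x - s * t * (f (- x) * g (- x)))) \<longlongrightarrow> 0) at_infinity"
    by (simp add: powr_add algebra_simps)
  ultimately show ?thesis
    using c unfolding parity_decay_def by auto
qed

lemma parity_decay_cmult:
  assumes "parity_decay s p f"
  shows "parity_decay s p (\<lambda>x. c * f x)"
proof -
  obtain R where R: "continuous_on {x. R < norm x} f"
    using assms unfolding parity_decay_def by blast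
  have c: "continuous_on {x. R < norm x} (\<lambda>x. c * f x)"
    by (intro continuous_intros R)
  have "((\<lambda>x. c * (norm x powr p * f x)) \<longlongrightarrow> c * 0) at_infinity"
    "((\<lambda>x. c * (norm x powr (p + 1) * (f x - s * f (- x)))) \<longlongrightarrow> c * 0) at_infinity"
    using assms unfolding parity_decay_def by (intro tendsto_mult_left; blast)+
  then have "((\<lambda>x. norm x powr p * (c * f x)) \<longlongrightarrow> 0) at_infinity"
    "((\<lambda>x. norm x powr (p + 1) * (c * f x - s * (c * f (- x)))) \<longlongrightarrow> 0) at_infinity"
    by (simp_all add: algebra_simps)
  then show ?thesis
    unfolding parity_decay_def using c by blast
qed

lemma parity_decay_minus: "parity_decay s p f \<Longrightarrow> parity_decay s p (\<lambda>x. - f x)"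
  using parity_decay_cmult[of s p f "-1"] by simp

lemma parity_decay_diff:
  "parity_decay s p f \<Longrightarrow> parity_decay s p g \<Longrightarrow> parity_decay s p (\<lambda>x. f x - g x)"
  using parity_decay_add[OF _ parity_decay_minus, of s p f g] by simp

lemma parity_decay_sum:
  "(\<And>i. i \<in> I \<Longrightarrow> parity_decay s p (f i)) \<Longrightarrow> parity_decay s p (\<lambda>x. \<Sum>i\<in>I. f i x)"
  by (induction I rule: infinite_finite_induct) (auto intro: parity_decay_add)

lemma parity_decay_weaken:
  assumes "parity_decay s p f" "q \<le> p"
  shows "parity_decay s q f"
  using assms powr_decay_mono[of p f q] powr_decay_mono[of "p + 1" "\<lambda>x. f x - s * f (- x)" "q + 1"]
  unfolding parity_decay_def by auto

lemma parity_decay_cong: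
  assumes f: "parity_decay s p f" and eq: "eventually (\<lambda>x. f x = g x) at_infinity"
  shows "parity_decay s p g"
proof -
  obtain R where R: "\<And>x. R \<le> norm x \<Longrightarrow> f x = g x"
    using eq unfolding eventually_at_infinity by blast
  obtain R' where R': "continuous_on {x. R' < norm x} f"
    using f unfolding parity_decay_def by blast
  have "continuous_on {x. max R R' < norm x} g"
    by (rule continuous_on_cong[THEN iffD1, OF refl _ continuous_on_subset[OF R']]) (auto simp: R)
  moreover have "((\<lambda>x. norm x powr p * g x) \<longlongrightarrow> 0) at_infinity"
  proof (rule Lim_transform_eventually)
    show "((\<lambda>x. norm x powr p * f x) \<longlongrightarrow> 0) at_infinity"
      using f unfolding parity_decay_def by blast
    show "\<forall>\<^sub>F x in at_infinity. norm x powr p * f x = norm x powr p * g x"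
      by (rule eventually_mono[OF eventually_norm_gt[of R]]) (simp add: R)
  qed
  moreover have "((\<lambda>x. norm x powr (p + 1) * (g x - s * g (- x))) \<longlongrightarrow> 0) at_infinity"
  proof (rule Lim_transform_eventually)
    show "((\<lambda>x. norm x powr (p + 1) * (f x - s * f (- x))) \<longlongrightarrow> 0) at_infinity"
      using f unfolding parity_decay_def by blast
    show "\<forall>\<^sub>F x in at_infinity. norm x powr (p + 1) * (f x - s * f (- x)) = norm x powr (p + 1) * (g x - s * g (- x))"
      by (rule eventually_mono[OF eventually_norm_gt[of R]]) (simp add: R)
  qed
  ultimately show ?thesis
    unfolding parity_decay_def by blast
qed

text \<open>Metric coefficients tend to constants instead of decaying, so the limit is subtracted. A
  constant is exactly even, so this leaves the odd part of \<open>f\<close> unchanged.\<close>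

definition even_near :: "real \<Rightarrow> real \<Rightarrow> ('a::real_normed_vector \<Rightarrow> real) \<Rightarrow> bool" where
  "even_near \<tau> c f \<longleftrightarrow> parity_decay 1 \<tau> (\<lambda>x. f x - c)"

lemma even_near_const [simp]: "even_near \<tau> c (\<lambda>_. c)"
  by (simp add: even_near_def)

lemma even_near_add: "even_near \<tau> c f \<Longrightarrow> even_near \<tau> d g \<Longrightarrow> even_near \<tau> (c + d) (\<lambda>x. f x + g x)"
  unfolding even_near_def using parity_decay_add[of 1 \<tau> "\<lambda>x. f x - c" "\<lambda>x. g x - d"]
  by (simp add: algebra_simps)

text \<open>The linearisation rule: freezing a coefficient at its limit gains \<tau> further powers
  and keeps the parity of the other factor.\<close>

lemma parity_decay_even_near_mult_diff:
  "even_near \<tau> c f \<Longrightarrow> parity_decay s p u \<Longrightarrow> parity_decay s (\<tau> + p) (\<lambda>x. f x * u x - c * u x)"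
  unfolding even_near_def using parity_decay_mult[of 1 \<tau> "\<lambda>x. f x - c" s p u]
  by (simp add: algebra_simps)

lemma parity_decay_even_near_mult:
  assumes "0 \<le> \<tau>" "even_near \<tau> c f" "parity_decay s p u"
  shows "parity_decay s p (\<lambda>x. f x * u x)"
proof -
  have "parity_decay s p (\<lambda>x. f x * u x - c * u x)"
    by (rule parity_decay_weaken[OF parity_decay_even_near_mult_diff]) (use assms in auto)
  from parity_decay_add[OF this parity_decay_cmult[OF assms(3), of c]] show ?thesis
    by simp
qed

lemma even_near_mult:
  assumes "0 \<le> \<tau>" "even_near \<tau> c f" "even_near \<tau> d g"
  shows "even_near \<tau> (c * d) (\<lambda>x. f x * g x)"
proof -
  have "parity_decay 1 \<tau> (\<lambda>x. f x * (g x - d))" "parity_decay 1 \<tau> (\<lambda>x. d * (f x - c))"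
    using assms parity_decay_even_near_mult parity_decay_cmult unfolding even_near_def by blast+
  from parity_decay_add[OF this] show ?thesis
    unfolding even_near_def by (simp add: algebra_simps)
qed

lemma even_near_sum:
  "(\<And>i. i \<in> I \<Longrightarrow> even_near \<tau> (c i) (f i)) \<Longrightarrow> even_near \<tau> (\<Sum>i\<in>I. c i) (\<lambda>x. \<Sum>i\<in>I. f i x)"
  by (induction I rule: infinite_finite_induct) (auto intro: even_near_add)

lemma even_near_prod:
  "0 \<le> \<tau> \<Longrightarrow> (\<And>i. i \<in> I \<Longrightarrow> even_near \<tau> (c i) (f i)) \<Longrightarrow> even_near \<tau> (\<Prod>i\<in>I. c i) (\<lambda>x. \<Prod>i\<in>I. f i x)"
  by (induction I rule: infinite_finite_induct) (auto intro: even_near_mult)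

lemma even_near_det:
  fixes M :: "'n::finite \<Rightarrow> 'n \<Rightarrow> 'a::real_normed_vector \<Rightarrow> real"
  assumes "0 \<le> \<tau>" "\<And>i j. even_near \<tau> (C i j) (M i j)"
  shows "even_near \<tau> (det (\<chi> i j. C i j)) (\<lambda>x. det (\<chi> i j. M i j x))"
  unfolding det_def by (simp, intro even_near_sum even_near_mult even_near_prod even_near_const assms)

lemma even_near_tendsto:
  assumes "0 \<le> \<tau>" "even_near \<tau> c f"
  shows "(f \<longlongrightarrow> c) at_infinity"
proof -
  have "((\<lambda>x. norm x powr 0 * (f x - c)) \<longlongrightarrow> 0) at_infinity"
    using assms powr_decay_mono[of \<tau> "\<lambda>x. f x - c" 0] unfolding even_near_def parity_decay_def by blast
  then have "((\<lambda>x. f x - c) \<longlongrightarrow> 0) at_infinity"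
    by (rule Lim_transform_eventually) (rule eventually_mono[OF eventually_norm_gt[of 0]], auto)
  then show ?thesis
    by (rule LIM_zero_cancel)
qed

text \<open>Both decay conditions compare two values of \<phi>, at \<open>f x\<close> and
  \<open>c\<close> or at \<open>f x\<close> and \<open>f (- x)\<close>, so a local Lipschitz bound
  transfers them directly.\<close>

lemma even_near_compose:
  fixes \<phi> :: "real \<Rightarrow> real"
  assumes \<tau>: "0 \<le> \<tau>" and f: "even_near \<tau> c f" and V: "open V" "c \<in> V"
    and lip: "\<And>u v. u \<in> V \<Longrightarrow> v \<in> V \<Longrightarrow> \<bar>\<phi> u - \<phi> v\<bar> \<le> L * \<bar>u - v\<bar>"
  shows "even_near \<tau> (\<phi> c) (\<lambda>x. \<phi> (f x))"
proof -
  have cV: "continuous_on V \<phi>"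
  proof (rule lipschitz_on_continuous_on[of "\<bar>L\<bar>"], rule lipschitz_onI)
    show "dist (\<phi> u) (\<phi> v) \<le> \<bar>L\<bar> * dist u v" if "u \<in> V" "v \<in> V" for u v
      using lip[OF that] mult_right_mono[OF abs_ge_self, of "dist u v" L] by (simp add: dist_real_def)
  qed simp
  have evV: "eventually (\<lambda>x. f x \<in> V) at_infinity"
    using even_near_tendsto[OF \<tau> f] V topological_tendstoD by blast
  then obtain R where R: "\<And>x. R \<le> norm x \<Longrightarrow> f x \<in> V"
    unfolding eventually_at_infinity by blast
  have f1: "((\<lambda>x. norm x powr \<tau> * (f x - c)) \<longlongrightarrow> 0) at_infinity"
    and f2: "((\<lambda>x. norm x powr (\<tau> + 1) * (f x - f (- x))) \<longlongrightarrow> 0) at_infinity"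
    using f unfolding even_near_def parity_decay_def by auto
  obtain R' where "continuous_on {x. R' < norm x} (\<lambda>x. f x - c)"
    using f unfolding even_near_def parity_decay_def by blast
  from continuous_on_add[OF this continuous_on_const[of _ c]] have "continuous_on {x. R' < norm x} f"
    by simp
  then have "continuous_on {x. max R R' < norm x} f"
    by (auto elim: continuous_on_subset)
  then have "continuous_on {x. max R R' < norm x} (\<lambda>x. \<phi> (f x) - \<phi> c)"
    by (intro continuous_intros continuous_on_compose2[OF cV]) (auto simp: R)
  moreover have "((\<lambda>x. norm x powr \<tau> * (\<phi> (f x) - \<phi> c)) \<longlongrightarrow> 0) at_infinity"
  proof (rule Lim_null_comparison)
    show "\<forall>\<^sub>F x in at_infinity. norm (norm x powr \<tau> * (\<phi> (f x) - \<phi> c)) \<le> L * \<bar>norm x powr \<tau> * (f x - c)\<bar>"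
      using evV
    proof eventually_elim
      case (elim x)
      have "norm x powr \<tau> * \<bar>\<phi> (f x) - \<phi> c\<bar> \<le> norm x powr \<tau> * (L * \<bar>f x - c\<bar>)"
        using lip[OF elim V(2)] by (intro mult_left_mono) auto
      then show ?case by (simp add: abs_mult mult_ac)
    qed
    show "((\<lambda>x. L * \<bar>norm x powr \<tau> * (f x - c)\<bar>) \<longlongrightarrow> 0) at_infinity"
      using tendsto_mult_right_zero[OF tendsto_rabs_zero[OF f1]] .
  qed
  moreover have "((\<lambda>x. norm x powr (\<tau> + 1) * (\<phi> (f x) - \<phi> (f (- x)))) \<longlongrightarrow> 0) at_infinity"
  proof (rule Lim_null_comparison)
    show "\<forall>\<^sub>F x in at_infinity. norm (norm x powr (\<tau> + 1) * (\<phi> (f x) - \<phi> (f (- x)))) \<le> L * \<bar>norm x powr (\<tau> + 1) * (f x - f (- x))\<bar>"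
      using eventually_norm_gt[of R]
    proof eventually_elim
      case (elim x)
      have "norm x powr (\<tau> + 1) * \<bar>\<phi> (f x) - \<phi> (f (- x))\<bar> \<le> norm x powr (\<tau> + 1) * (L * \<bar>f x - f (- x)\<bar>)"
        using elim by (intro mult_left_mono lip R) auto
      then show ?case by (simp add: abs_mult mult_ac)
    qed
    show "((\<lambda>x. L * \<bar>norm x powr (\<tau> + 1) * (f x - f (- x))\<bar>) \<longlongrightarrow> 0) at_infinity"
      using tendsto_mult_right_zero[OF tendsto_rabs_zero[OF f2]] .
  qed
  ultimately show ?thesis
    unfolding even_near_def parity_decay_def by (auto simp del: max_less_iff_conj)
qed

lemma even_near_inverse:
  assumes "0 \<le> \<tau>" "even_near \<tau> 1 f"
  shows "even_near \<tau> 1 (\<lambda>x. inverse (f x))"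
proof -
  \<comment> \<open>Above 1/2 the product \<open>u * v\<close> is at least 1/4, whence the Lipschitz
    constant 4.\<close>
  have "\<bar>inverse u - inverse v\<bar> \<le> 4 * \<bar>u - v\<bar>" if "u \<in> {1/2<..}" "v \<in> {1/2<..}" for u v :: real
  proof -
    have uv: "1/4 \<le> u * v" using that mult_mono[of "1/2" u "1/2" v] by auto
    have "\<bar>inverse u - inverse v\<bar> = \<bar>u - v\<bar> / (u * v)"
      using that by (auto simp: field_simps abs_if)
    also have "\<dots> \<le> \<bar>u - v\<bar> / (1/4)"
      using uv by (intro divide_left_mono) auto
    finally show ?thesis by simp
  qed
  from even_near_compose[OF assms _ _ this, of "{1/2<..}"] show ?thesis by auto
qed

lemma even_near_sqrt:
  assumes "0 \<le> \<tau>" "even_near \<tau> 1 f"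
  shows "even_near \<tau> 1 (\<lambda>x. sqrt (f x))"
proof -
  \<comment> \<open>Above 1/2 both roots are at least 1/2, so their sum is at least 1 and the
    constant 1 suffices.\<close>
  have "\<bar>sqrt u - sqrt v\<bar> \<le> 1 * \<bar>u - v\<bar>" if "u \<in> {1/2<..}" "v \<in> {1/2<..}" for u v :: real
  proof -
    have "1/2 \<le> sqrt u" "1/2 \<le> sqrt v"
      using that real_le_rsqrt[of "1/2" u] real_le_rsqrt[of "1/2" v] by (auto simp: power2_eq_square)
    then have "\<bar>sqrt u - sqrt v\<bar> * 1 \<le> \<bar>sqrt u - sqrt v\<bar> * (sqrt u + sqrt v)"
      by (intro mult_left_mono) auto
    also have "\<dots> = \<bar>(sqrt u - sqrt v) * (sqrt u + sqrt v)\<bar>"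
      using that by (simp add: abs_mult)
    also have "(sqrt u - sqrt v) * (sqrt u + sqrt v) = u - v"
      using that by (simp add: algebra_simps)
    finally show ?thesis by simp
  qed
  from even_near_compose[OF assms _ _ this, of "{1/2<..}"] show ?thesis by auto
qed

section \<open>Curvature of asymptotically even metrics\<close>

lemma matrix_inv_inverse:
  fixes A :: "real^'n^'n"
  assumes "det A \<noteq> 0"
  shows "A ** matrix_inv A = mat 1" "matrix_inv A ** A = mat 1"
proof -
  have "\<exists>B. A ** B = mat 1 \<and> B ** A = mat 1"
    using assms invertible_det_nz[of A] unfolding invertible_def by blast
  then have "A ** matrix_inv A = mat 1 \<and> matrix_inv A ** A = mat 1"
    unfolding matrix_inv_def by (rule someI_ex)
  then show "A ** matrix_inv A = mat 1" "matrix_inv A ** A = mat 1" by auto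
qed

lemma mat_1_component: "(mat 1 :: real^'n^'n) $ i $ j = kd i j"
  by (simp add: mat_def kd_def)

lemma mat_1_kd: "(mat 1 :: real^'n^'n) = (\<chi> i j. kd i j)"
  by (simp add: vec_eq_iff mat_1_component)

text \<open>Expresses the inverse through determinants, that is, sums of products of entries, to
  which the parity rules and the differentiation rules apply.\<close>

lemma matrix_inv_cramer:
  fixes A :: "real^'n^'n"
  assumes "det A \<noteq> 0"
  shows "matrix_inv A $ i $ k = det (\<chi> a b. if b = i then kd a k else A$a$b) / det A"
proof -
  let ?x = "matrix_inv A *v axis k 1"
  have "A *v ?x = axis k 1"
    using matrix_inv_inverse(1)[OF assms] by (simp add: matrix_vector_mul_assoc)
  then have "?x $ i = det (\<chi> a b. if b = i then axis k 1 $ a else A$a$b) / det A"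
    using cramer[OF assms, of ?x "axis k 1"] by simp
  moreover have "?x $ i = matrix_inv A $ i $ k"
    by (simp add: matrix_vector_mult_def axis_def if_distrib cong: if_cong)
  moreover have "(axis k 1 $ a :: real) = kd a k" for a
    by (simp add: axis_def kd_def)
  ultimately show ?thesis by (simp cong: if_cong)
qed

lemma differentiable_prodI:
  fixes f :: "'k \<Rightarrow> 'a::real_normed_vector \<Rightarrow> real"
  shows "(\<And>i. i \<in> I \<Longrightarrow> f i differentiable (at x)) \<Longrightarrow> (\<lambda>x. \<Prod>i\<in>I. f i x) differentiable (at x)"
  by (induction I rule: infinite_finite_induct) auto

lemma differentiable_det:
  fixes M :: "'n::finite \<Rightarrow> 'n \<Rightarrow> 'a::real_normed_vector \<Rightarrow> real"
  assumes "\<And>i j. M i j differentiable (at x)"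
  shows "(\<lambda>x. det (\<chi> i j. M i j x)) differentiable (at x)"
  unfolding det_def by (simp, intro differentiable_sumI differentiable_mult differentiable_const differentiable_prodI assms)

lemma parity_decay_even_near_mult_approx:
  assumes "even_near \<tau> c f" "parity_decay s p u" "parity_decay s (\<tau> + p) (\<lambda>x. u x - v x)"
  shows "parity_decay s (\<tau> + p) (\<lambda>x. f x * u x - c * v x)"
  using parity_decay_add[OF parity_decay_even_near_mult_diff[OF assms(1,2)] parity_decay_cmult[OF assms(3), of c]]
  by (simp add: algebra_simps)

lemma open_exterior: "open {x::'a::real_normed_vector. R < norm x}"
  by (intro open_Collect_less continuous_intros)

text \<open>Twice the Christoffel symbol of the first kind; being linear in \<open>g\<close>, it is
  the part of the connection that survives linearisation.\<close>

definition lowered_christoffel :: "('n \<Rightarrow> 'n \<Rightarrow> real^'n \<Rightarrow> real) \<Rightarrow> 'n \<Rightarrow> 'n \<Rightarrow> 'n \<Rightarrow> real^'n \<Rightarrow> real" where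
  "lowered_christoffel g l i j x = pd (g l i) j x + pd (g l j) i x - pd (g i j) l x"

text \<open>Each derivative flips the parity and gains one power: \<open>g\<close> is even, its
  first derivatives odd, its second derivatives even, up to faster decaying errors. The exponent
  stays general; the final choice makes \<open>2 * \<tau> + 2\<close> equal to the
  dimension.\<close>

locale asymptotically_even_metric =
  fixes g :: "'n::finite \<Rightarrow> 'n \<Rightarrow> real^'n \<Rightarrow> real" and \<tau> R0 :: real
  assumes \<tau>: "0 \<le> \<tau>"
    and sym: "\<And>i j x. R0 < norm x \<Longrightarrow> g i j x = g j i x"
    and d1: "\<And>i j x. R0 < norm x \<Longrightarrow> g i j differentiable (at x)"
    and d2: "\<And>i j k x. R0 < norm x \<Longrightarrow> pd (g i j) k differentiable (at x)"
    and c2: "\<And>i j k l. continuous_on {x. R0 < norm x} (pd (pd (g i j) k) l)"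
    and h0: "\<And>i j. even_near \<tau> (kd i j) (g i j)"
    and h1: "\<And>i j k. parity_decay (-1) (\<tau> + 1) (pd (g i j) k)"
    and h2: "\<And>i j k l. parity_decay 1 (\<tau> + 2) (pd (pd (g i j) k) l)"
begin

abbreviation hess :: "real^'n \<Rightarrow> 'n \<Rightarrow> 'n \<Rightarrow> 'n \<Rightarrow> 'n \<Rightarrow> real" where
  "hess x \<equiv> \<lambda>i j k l. pd (pd (g i j) k) l x"

lemma det_near: "even_near \<tau> 1 (\<lambda>x. det (gmat g x))"
  using even_near_det[OF \<tau>, of kd g, OF h0] mat_1_kd[where 'n='n] det_I[where 'n='n, where 'a=real] unfolding gmat_def by simp

lemma eventually_det_nonzero: "eventually (\<lambda>x. det (gmat g x) \<noteq> 0) at_infinity"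
  using tendsto_imp_eventually_ne[OF even_near_tendsto[OF \<tau> det_near]] by simp

definition R1 :: real where
  "R1 = (SOME R. R0 \<le> R \<and> (\<forall>x. R < norm x \<longrightarrow> det (gmat g x) \<noteq> 0))"

lemma R1: "R0 \<le> R1" "R1 < norm x \<Longrightarrow> det (gmat g x) \<noteq> 0"
proof -
  obtain R where R: "\<And>x. R \<le> norm x \<Longrightarrow> det (gmat g x) \<noteq> 0"
    using eventually_det_nonzero unfolding eventually_at_infinity by blast
  have "\<exists>R. R0 \<le> R \<and> (\<forall>x. R < norm x \<longrightarrow> det (gmat g x) \<noteq> 0)"
  proof (intro exI[of _ "max R0 R"] conjI allI impI)
    show "det (gmat g x) \<noteq> 0" if "max R0 R < norm x" for x
      using that by (intro R) simp
  qed simp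
  from someI_ex[OF this] show "R0 \<le> R1" "R1 < norm x \<Longrightarrow> det (gmat g x) \<noteq> 0"
    unfolding R1_def by auto
qed

lemma R0_R1: "R1 < norm x \<Longrightarrow> R0 < norm x"
  using R1(1) by linarith

lemma ev_R1: "eventually (\<lambda>x::real^'n. R1 < norm x) at_infinity"
  by (rule eventually_norm_gt)

lemma ginv_cramer:
  "R1 < norm x \<Longrightarrow> ginv g i k x = det (\<chi> a b. if b = i then kd a k else g a b x) * inverse (det (gmat g x))"
  unfolding ginv_def using matrix_inv_cramer[OF R1(2)]
  by (simp add: gmat_def divide_inverse cong: if_cong)

lemma ginv_near: "even_near \<tau> (kd i k) (ginv g i k)"
proof -
  have "even_near \<tau> (if b = i then kd a k else kd a b) (\<lambda>x. if b = i then kd a k else g a b x)" for a b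
    using h0 by (cases "b = i") simp_all
  then have "even_near \<tau> (det (\<chi> a b. if b = i then kd a k else kd a b)) (\<lambda>x. det (\<chi> a b. if b = i then kd a k else g a b x))"
    by (rule even_near_det[OF \<tau>])
  then have "even_near \<tau> (det (\<chi> a b. if b = i then kd a k else kd a b) * 1)
      (\<lambda>x. det (\<chi> a b. if b = i then kd a k else g a b x) * inverse (det (gmat g x)))"
    by (intro even_near_mult even_near_inverse det_near \<tau>)
  \<comment> \<open>Cramer's rule read backwards: for the identity matrix this determinant is an
    entry of the inverse, again the identity.\<close>
  moreover have "det (\<chi> a b. if b = i then kd a k else kd a b) = kd i k"
  proof -
    have "matrix_inv (mat 1 :: real^'n^'n) = mat 1"
      using matrix_inv_inverse(1)[of "mat 1 :: real^'n^'n"] by simp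
    then show ?thesis
      using matrix_inv_cramer[of "mat 1 :: real^'n^'n" i k] by (simp add: mat_1_component cong: if_cong)
  qed
  ultimately show ?thesis
    unfolding even_near_def
    by (auto elim!: parity_decay_cong intro!: eventually_mono[OF ev_R1] simp: ginv_cramer)
qed

lemma ginv_differentiable:
  assumes "R1 < norm x"
  shows "ginv g i k differentiable (at x)"
proof -
  have "(\<lambda>y. if b = i then kd a k else g a b y) differentiable (at x)" for a b
    using d1[OF R0_R1[OF assms]] by (cases "b = i") simp_all
  then have "(\<lambda>y. det (\<chi> a b. if b = i then kd a k else g a b y)) differentiable (at x)"
    by (rule differentiable_det)
  moreover have "(\<lambda>y. det (gmat g y)) differentiable (at x)"
    unfolding gmat_def by (rule differentiable_det) (rule d1[OF R0_R1[OF assms]])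
  ultimately have "(\<lambda>y. det (\<chi> a b. if b = i then kd a k else g a b y) * inverse (det (gmat g y))) differentiable (at x)"
    using R1(2)[OF assms] by (intro differentiable_mult differentiable_inverse)
  then obtain D where D: "((\<lambda>y. det (\<chi> a b. if b = i then kd a k else g a b y) * inverse (det (gmat g y))) has_derivative D) (at x)"
    unfolding differentiable_def by blast
  have "(ginv g i k has_derivative D) (at x)"
    by (rule has_derivative_transform_within_open[OF D open_exterior[of R1]]) (simp_all add: assms ginv_cramer)
  then show ?thesis
    unfolding differentiable_def by blast
qed

lemma ginv_g: "R1 < norm x \<Longrightarrow> (\<Sum>b\<in>UNIV. ginv g a b x * g b c x) = kd a c"
  and g_ginv: "R1 < norm x \<Longrightarrow> (\<Sum>b\<in>UNIV. g a b x * ginv g b c x) = kd a c"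
proof -
  assume x: "R1 < norm x"
  have "(matrix_inv (gmat g x) ** gmat g x) $ a $ c = kd a c" "(gmat g x ** matrix_inv (gmat g x)) $ a $ c = kd a c"
    using matrix_inv_inverse[OF R1(2)[OF x]] by (simp_all add: mat_1_component)
  then show "(\<Sum>b\<in>UNIV. ginv g a b x * g b c x) = kd a c" "(\<Sum>b\<in>UNIV. g a b x * ginv g b c x) = kd a c"
    by (simp_all add: matrix_matrix_mult_def ginv_def gmat_def)
qed

text \<open>Differentiate \<open>ginv\<close> times \<open>g\<close> = \<open>kd\<close> and
  multiply by \<open>ginv\<close> from the right. This writes the derivative through quantities of
  known decay, with no derivative of Cramer's formula to estimate.\<close>

lemma pd_ginv:
  assumes x: "R1 < norm x"
  shows "pd (ginv g a e) m x = - (\<Sum>c\<in>UNIV. \<Sum>b\<in>UNIV. ginv g a b x * (ginv g c e x * pd (g b c) m x))"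
proof -
  have 0: "(\<Sum>b\<in>UNIV. pd (ginv g a b) m x * g b c x) = - (\<Sum>b\<in>UNIV. ginv g a b x * pd (g b c) m x)" for c
  proof -
    have "pd (\<lambda>x. \<Sum>b\<in>UNIV. ginv g a b x * g b c x) m x = pd (\<lambda>x. kd a c) m x"
      by (rule pd_cong[OF open_exterior[of R1]]) (use x ginv_g in auto)
    then show ?thesis
      by (simp add: pd_sum pd_mult ginv_differentiable[OF x] d1[OF R0_R1[OF x]] differentiable_intros sum.distrib)
  qed
  have "pd (ginv g a e) m x = (\<Sum>b\<in>UNIV. pd (ginv g a b) m x * (\<Sum>c\<in>UNIV. g b c x * ginv g c e x))"
    by (simp add: g_ginv[OF x])
  also have "\<dots> = (\<Sum>c\<in>UNIV. (\<Sum>b\<in>UNIV. pd (ginv g a b) m x * g b c x) * ginv g c e x)"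
    unfolding sum_distrib_left sum_distrib_right by (subst sum.swap) (simp add: mult.assoc)
  also have "\<dots> = - (\<Sum>c\<in>UNIV. \<Sum>b\<in>UNIV. ginv g a b x * (ginv g c e x * pd (g b c) m x))"
    unfolding 0 by (simp add: sum_distrib_left sum_negf mult_ac)
  finally show ?thesis .
qed

lemma pd_ginv_decay: "parity_decay (-1) (\<tau> + 1) (pd (ginv g a e) m)"
proof (rule parity_decay_cong)
  show "parity_decay (-1) (\<tau> + 1) (\<lambda>x. - (\<Sum>c\<in>UNIV. \<Sum>b\<in>UNIV. ginv g a b x * (ginv g c e x * pd (g b c) m x)))"
    by (intro parity_decay_minus parity_decay_sum parity_decay_even_near_mult[OF \<tau> ginv_near] h1)
qed (rule eventually_mono[OF ev_R1], simp add: pd_ginv)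

lemma lowered_christoffel_decay: "parity_decay (-1) (\<tau> + 1) (lowered_christoffel g l i j)"
  unfolding lowered_christoffel_def by (intro parity_decay_add parity_decay_diff h1)

lemma lowered_christoffel_differentiable: "R0 < norm x \<Longrightarrow> lowered_christoffel g l i j differentiable (at x)"
  unfolding lowered_christoffel_def by (intro differentiable_intros d2)

lemma pd_lowered_christoffel:
  "R0 < norm x \<Longrightarrow> pd (lowered_christoffel g l i j) m x = hess x l i j m + hess x l j i m - hess x i j l m"
  unfolding lowered_christoffel_def by (simp add: pd_add pd_diff d2 differentiable_intros)

lemma pd_lowered_christoffel_decay: "parity_decay 1 (\<tau> + 2) (pd (lowered_christoffel g l i j) m)"
proof (rule parity_decay_cong)
  show "parity_decay 1 (\<tau> + 2) (\<lambda>x. hess x l i j m + hess x l j i m - hess x i j l m)"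
    by (intro parity_decay_add parity_decay_diff h2)
qed (rule eventually_mono[OF ev_R1], simp add: pd_lowered_christoffel R0_R1)

lemma christoffel_alt: "christoffel g k i j = (\<lambda>x. 1/2 * (\<Sum>l\<in>UNIV. ginv g k l x * lowered_christoffel g l i j x))"
  by (rule ext) (simp add: christoffel_def lowered_christoffel_def)

lemma christoffel_decay: "parity_decay (-1) (\<tau> + 1) (christoffel g k i j)"
  unfolding christoffel_alt
  by (intro parity_decay_cmult parity_decay_sum parity_decay_even_near_mult[OF \<tau> ginv_near] lowered_christoffel_decay)

lemma pd_christoffel:
  assumes x: "R1 < norm x"
  shows "pd (christoffel g k i j) m x = 1/2 * (\<Sum>l\<in>UNIV. pd (ginv g k l) m x * lowered_christoffel g l i j x
      + ginv g k l x * pd (lowered_christoffel g l i j) m x)"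
  unfolding christoffel_alt
  by (subst pd_cmult)
     (simp_all add: pd_sum pd_mult ginv_differentiable[OF x] lowered_christoffel_differentiable[OF R0_R1[OF x]] differentiable_intros)

text \<open>Two errors, both quadratically small: a derivative of \<open>ginv\<close> times a first
  derivative of \<open>g\<close> has exponents (\<tau> + 1) + (\<tau> + 1) and is odd times odd;
  \<open>ginv - kd\<close> times a second derivative has \<tau> + (\<tau> + 2) and is even times
  even.\<close>

lemma pd_christoffel_approx:
  "parity_decay 1 (2 * \<tau> + 2) (\<lambda>x. pd (christoffel g k i j) m x - 1/2 * pd (lowered_christoffel g k i j) m x)"
proof (rule parity_decay_cong)
  let ?f = "\<lambda>x. 1/2 * (\<Sum>l\<in>UNIV. pd (ginv g k l) m x * lowered_christoffel g l i j x
      + (ginv g k l x * pd (lowered_christoffel g l i j) m x - kd k l * pd (lowered_christoffel g l i j) m x))"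
  have "parity_decay 1 (2 * \<tau> + 2) (\<lambda>x. pd (ginv g k l) m x * lowered_christoffel g l i j x)" for l
    using parity_decay_mult[OF pd_ginv_decay lowered_christoffel_decay] by (simp add: algebra_simps)
  moreover have "parity_decay 1 (2 * \<tau> + 2) (\<lambda>x. ginv g k l x * pd (lowered_christoffel g l i j) m x - kd k l * pd (lowered_christoffel g l i j) m x)" for l
    using parity_decay_even_near_mult_diff[OF ginv_near pd_lowered_christoffel_decay] by (simp add: algebra_simps)
  ultimately show "parity_decay 1 (2 * \<tau> + 2) ?f"
    by (intro parity_decay_cmult parity_decay_sum parity_decay_add)
  show "eventually (\<lambda>x. ?f x = pd (christoffel g k i j) m x - 1/2 * pd (lowered_christoffel g k i j) m x) at_infinity"
    by (rule eventually_mono[OF ev_R1]) (simp add: pd_christoffel sum.distrib sum_subtractf field_simps)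
qed

lemma hess_sym:
  assumes x: "R0 < norm x"
  shows "hess x i j k l = hess x j i k l"
proof (rule pd_cong[OF open_exterior[of R0]])
  show "pd (g i j) k y = pd (g j i) k y" if "y \<in> {x. R0 < norm x}" for y
    by (rule pd_cong[OF open_exterior[of R0] that]) (simp add: sym)
qed (use x in simp)

text \<open>In the derivative of \<open>lowered_christoffel g k i k\<close> the first and last terms
  cancel by symmetry of \<open>g\<close>, leaving only the Hessian of the trace.\<close>

lemma lin_ricci_alt:
  assumes x: "R0 < norm x"
  shows "lin_ricci (hess x) i j
    = (\<Sum>k\<in>UNIV. 1/2 * pd (lowered_christoffel g k i j) k x - 1/2 * pd (lowered_christoffel g k i k) j x)"
  unfolding lin_ricci_def sum_distrib_left
  by (rule sum.cong) (simp_all add: pd_lowered_christoffel[OF x] hess_sym[OF x, of _ i] field_simps)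

lemma lin_ricci_decay: "parity_decay 1 (\<tau> + 2) (\<lambda>x. lin_ricci (hess x) i j)"
  unfolding lin_ricci_def by (intro parity_decay_cmult parity_decay_sum parity_decay_add parity_decay_diff h2)

lemma ricci_approx: "parity_decay 1 (2 * \<tau> + 2) (\<lambda>x. ricci g i j x - lin_ricci (hess x) i j)"
proof (rule parity_decay_cong)
  let ?f = "\<lambda>x. (\<Sum>k\<in>UNIV. (pd (christoffel g k i j) k x - 1/2 * pd (lowered_christoffel g k i j) k x)
      - (pd (christoffel g k i k) j x - 1/2 * pd (lowered_christoffel g k i k) j x))
     + (\<Sum>k\<in>UNIV. \<Sum>l\<in>UNIV. christoffel g k k l x * christoffel g l i j x - christoffel g k j l x * christoffel g l i k x)"
  have "parity_decay 1 (2 * \<tau> + 2) (\<lambda>x. christoffel g k i j x * christoffel g k' i' j' x)" for k i j k' i' j'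
    using parity_decay_mult[OF christoffel_decay christoffel_decay] by (simp add: algebra_simps)
  then show "parity_decay 1 (2 * \<tau> + 2) ?f"
    by (intro parity_decay_add parity_decay_sum parity_decay_diff pd_christoffel_approx)
  show "eventually (\<lambda>x. ?f x = ricci g i j x - lin_ricci (hess x) i j) at_infinity"
  proof (rule eventually_mono[OF ev_R1])
    fix x :: "real^'n" assume x: "R1 < norm x"
    show "?f x = ricci g i j x - lin_ricci (hess x) i j"
      unfolding lin_ricci_alt[OF R0_R1[OF x]] ricci_def by (simp add: sum_subtractf)
  qed
qed

lemma ricci_decay: "parity_decay 1 (\<tau> + 2) (ricci g i j)"
proof -
  have "parity_decay 1 (\<tau> + 2) (\<lambda>x. (ricci g i j x - lin_ricci (hess x) i j) + lin_ricci (hess x) i j)"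
    by (intro parity_decay_add lin_ricci_decay parity_decay_weaken[OF ricci_approx]) (use \<tau> in simp)
  then show ?thesis by simp
qed

text \<open>The exponent is rewritten in the shape \<open>\<tau> + p\<close> that
  \<open>parity_decay_even_near_mult_approx\<close> expects.\<close>

lemma ricci_approx': "parity_decay 1 (\<tau> + (\<tau> + 2)) (\<lambda>x. ricci g i j x - lin_ricci (hess x) i j)"
  using ricci_approx by (simp add: algebra_simps)

lemma scal_approx: "parity_decay 1 (\<tau> + (\<tau> + 2)) (\<lambda>x. scal g x - (\<Sum>k\<in>UNIV. lin_ricci (hess x) k k))"
proof -
  have "parity_decay 1 (\<tau> + (\<tau> + 2)) (\<lambda>x. \<Sum>i\<in>UNIV. \<Sum>j\<in>UNIV. ginv g i j x * ricci g i j x - kd i j * lin_ricci (hess x) i j)"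
    by (intro parity_decay_sum parity_decay_even_near_mult_approx ginv_near ricci_decay ricci_approx')
  then show ?thesis
    by (simp add: scal_def sum_subtractf)
qed

lemma scal_decay: "parity_decay 1 (\<tau> + 2) (scal g)"
  unfolding scal_def by (intro parity_decay_sum parity_decay_even_near_mult[OF \<tau> ginv_near] ricci_decay)

lemma einstein_approx: "parity_decay 1 (\<tau> + (\<tau> + 2)) (\<lambda>x. einstein g i j x - lin_einstein (hess x) i j)"
proof -
  have "parity_decay 1 (\<tau> + (\<tau> + 2)) (\<lambda>x. (ricci g i j x - lin_ricci (hess x) i j)
      - 1/2 * (g i j x * scal g x - kd i j * (\<Sum>k\<in>UNIV. lin_ricci (hess x) k k)))"
    by (intro parity_decay_diff parity_decay_cmult ricci_approx' parity_decay_even_near_mult_approx h0 scal_decay scal_approx)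
  then show ?thesis
    by (simp add: einstein_def lin_einstein_def algebra_simps)
qed

lemma einstein_decay: "parity_decay 1 (\<tau> + 2) (einstein g i j)"
proof -
  have "parity_decay 1 (\<tau> + 2) (\<lambda>x. ricci g i j x - 1/2 * (g i j x * scal g x))"
    by (intro parity_decay_diff parity_decay_cmult ricci_decay parity_decay_even_near_mult[OF \<tau> h0] scal_decay)
  then show ?thesis
    by (simp add: einstein_def[abs_def] algebra_simps)
qed

text \<open>The Einstein tensor with one index raised, times the volume density. Contracted with
  \<open>Y\<close> and the Euclidean normal it is the integrand of \<open>c_I\<close>, since the
  conormal length cancels between \<open>nu_g\<close> and \<open>area_g\<close>; only coefficients
  independent of the normal need to be expanded.\<close>

definition einstein_flux :: "'n \<Rightarrow> 'n \<Rightarrow> real^'n \<Rightarrow> real" where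
  "einstein_flux i k x = sqrt (det (gmat g x)) * (\<Sum>j\<in>UNIV. ginv g j k x * einstein g i j x)"

lemma einstein_flux_approx: "parity_decay 1 (2 * \<tau> + 2) (\<lambda>x. einstein_flux i k x - lin_einstein (hess x) i k)"
proof -
  have "parity_decay 1 (\<tau> + (\<tau> + 2)) (\<lambda>x. \<Sum>j\<in>UNIV. ginv g j k x * einstein g i j x - kd j k * lin_einstein (hess x) i j)"
    by (intro parity_decay_sum parity_decay_even_near_mult_approx ginv_near einstein_decay einstein_approx)
  then have "parity_decay 1 (\<tau> + (\<tau> + 2)) (\<lambda>x. (\<Sum>j\<in>UNIV. ginv g j k x * einstein g i j x) - lin_einstein (hess x) i k)"
    by (simp add: sum_subtractf)
  then have "parity_decay 1 (\<tau> + (\<tau> + 2)) (\<lambda>x. einstein_flux i k x - 1 * lin_einstein (hess x) i k)"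
    unfolding einstein_flux_def
    by (intro parity_decay_even_near_mult_approx even_near_sqrt[OF \<tau> det_near] parity_decay_sum
        parity_decay_even_near_mult[OF \<tau> ginv_near] einstein_decay)
  then show ?thesis by (simp add: algebra_simps)
qed

end

section \<open>The flux through large spheres\<close>

text \<open>Reflection in the origin preserves the integral and \<open>w\<close> is odd, so twice
  the integral equals that of \<open>(T x - T (- x)) * w x\<close>, where the faster decay of the
  odd part of \<open>T\<close> applies.\<close>

lemma sphere_int_parity_tendsto:
  fixes T w :: "real^'n \<Rightarrow> real"
  assumes T: "parity_decay 1 (real CARD('n)) T"
    and w: "continuous_on (- {0}) w" "\<And>x. w (- x) = - w x" "\<And>x. \<bar>w x\<bar> \<le> C * (norm x)\<^sup>2"
  shows "((\<lambda>r. sphere_int r (\<lambda>x. T x * w x)) \<longlongrightarrow> 0) at_top"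
proof (rule tendstoI)
  fix e :: real assume e: "e > 0"
  define K where "K = \<bar>omega TYPE('n)\<bar> * \<bar>C\<bar>"
  \<comment> \<open>Adding 1 to \<open>K\<close> keeps the quotient meaningful when
    \<open>K = 0\<close> and makes \<open>K * \<epsilon> < e\<close> strict.\<close>
  define \<epsilon> where "\<epsilon> = e / (K + 1)"
  have K: "K \<ge> 0" by (simp add: K_def)
  then have \<epsilon>: "\<epsilon> > 0" using e by (simp add: \<epsilon>_def add_nonneg_pos)
  obtain R where R: "continuous_on {x. R < norm x} T"
    using T unfolding parity_decay_def by blast
  have "((\<lambda>x. norm x powr (real CARD('n) + 1) * (T x - T (- x))) \<longlongrightarrow> 0) at_infinity"
    using T unfolding parity_decay_def by auto
  from tendstoD[OF this \<epsilon>] obtain b where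
    b: "\<And>x. b \<le> norm x \<Longrightarrow> norm x powr (real CARD('n) + 1) * \<bar>T x - T (- x)\<bar> < \<epsilon>"
    unfolding eventually_at_infinity by (auto simp: abs_mult)
  show "eventually (\<lambda>r. dist (sphere_int r (\<lambda>x. T x * w x)) 0 < e) at_top"
    using eventually_gt_at_top[of "max 0 (max R b)"]
  proof eventually_elim
    case (elim r)
    then have r: "r > 0" "r > R" "r > b" by auto
    have cT: "continuous_on (sphere 0 r) T"
      using r by (intro continuous_on_subset[OF R]) auto
    have cw: "continuous_on (sphere 0 r) w"
      using r by (intro continuous_on_subset[OF w(1)]) auto
    have cT': "continuous_on (sphere 0 r) (\<lambda>x. T (- x))"
      by (rule continuous_on_compose2[OF cT]) (auto intro: continuous_intros)
    have orth: "orthogonal_transformation (uminus :: real^'n \<Rightarrow> real^'n)"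
      by (auto simp: orthogonal_transformation_def linear_iff)
    have "sphere_int r (\<lambda>x. T (- x) * w (- x)) = sphere_int r (\<lambda>x. T x * w x)"
      using sphere_int_orthogonal[OF r(1) continuous_on_mult[OF cT cw] orth] by simp
    then have "sphere_int r (\<lambda>x. T x * w x) + sphere_int r (\<lambda>x. T x * w x)
      = sphere_int r (\<lambda>x. T x * w x) + sphere_int r (\<lambda>x. T (- x) * - w x)"
      by (simp add: w(2))
    also have "\<dots> = sphere_int r (\<lambda>x. T x * w x + T (- x) * - w x)"
      by (rule sphere_int_add[OF r(1), symmetric]) (intro continuous_intros cT cw cT')+
    also have "\<dots> = sphere_int r (\<lambda>x. (T x - T (- x)) * w x)"
      by (simp add: algebra_simps)
    finally have two: "2 * sphere_int r (\<lambda>x. T x * w x) = sphere_int r (\<lambda>x. (T x - T (- x)) * w x)"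
      by simp
    \<comment> \<open>Area and weight together grow like r^(n+1), exactly the rate controlled by the
      odd part of \<open>T\<close>. The natural-number subtraction is harmless, the dimension being
      positive.\<close>
    have n: "r powr (real CARD('n) + 1) = r ^ (CARD('n) - 1) * r\<^sup>2"
    proof -
      have "r powr (real CARD('n) + 1) = r ^ (CARD('n) - 1 + 2)"
        using r(1) powr_realpow[OF r(1), of "CARD('n) + 1"] by (simp add: add.commute Suc_diff_1)
      then show ?thesis by (simp only: power_add)
    qed
    have "\<bar>sphere_int r (\<lambda>x. (T x - T (- x)) * w x)\<bar> \<le> r ^ (CARD('n) - 1) * omega TYPE('n) * (\<epsilon> / r powr (real CARD('n) + 1) * (\<bar>C\<bar> * r\<^sup>2))"
    proof (rule sphere_int_bound[OF r(1)])
      show "continuous_on (sphere 0 r) (\<lambda>x. (T x - T (- x)) * w x)"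
        by (intro continuous_intros cT cw cT')
      show "\<bar>(T x - T (- x)) * w x\<bar> \<le> \<epsilon> / r powr (real CARD('n) + 1) * (\<bar>C\<bar> * r\<^sup>2)" if "norm x = r" for x
      proof -
        have "\<bar>T x - T (- x)\<bar> \<le> \<epsilon> / r powr (real CARD('n) + 1)"
          using b[of x] that r by (simp add: field_simps)
        moreover have "\<bar>w x\<bar> \<le> \<bar>C\<bar> * r\<^sup>2"
          using w(3)[of x] that mult_right_mono[OF abs_ge_self, of "r\<^sup>2" C] by simp
        ultimately show ?thesis
          using \<epsilon> unfolding abs_mult by (intro mult_mono) auto
      qed
    qed
    also have "\<dots> = omega TYPE('n) * \<bar>C\<bar> * \<epsilon>"
      using r(1) by (simp add: n)
    also have "\<dots> \<le> K * \<epsilon>"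
      using \<epsilon> by (simp add: K_def mult_right_mono)
    also have "\<dots> < e"
      using e K by (simp add: \<epsilon>_def field_simps)
    finally have "\<bar>sphere_int r (\<lambda>x. T x * w x)\<bar> < e"
      unfolding two[symmetric] by simp
    then show ?case by simp
  qed
qed

lemma nu_e_component_le: "\<bar>nu_e x $ k\<bar> \<le> 1"
proof -
  have "norm (nu_e x) \<le> 1"
    by (cases "x = 0") (simp_all add: nu_e_def)
  then show ?thesis
    using component_le_norm_cart[of "nu_e x" k] by linarith
qed

lemma continuous_nu_e: "continuous_on (- {0}) (\<lambda>x. nu_e x $ k)"
  unfolding nu_e_def by (intro continuous_intros) auto

lemma continuous_Yfield: "continuous_on A (\<lambda>x. Yfield a x $ i)"
  unfolding Yfield_component by (intro continuous_intros)

lemma Yfield_bound: "\<bar>Yfield a x $ i\<bar> \<le> 3 * (norm x)\<^sup>2"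
proof -
  have "\<bar>x $ a * x $ i\<bar> \<le> norm x * norm x"
    unfolding abs_mult by (intro mult_mono component_le_norm_cart) auto
  moreover have "\<bar>(norm x)\<^sup>2 * (if a = i then 1 else 0)\<bar> \<le> (norm x)\<^sup>2"
    by simp
  moreover have "Yfield a x $ i = (norm x)\<^sup>2 * (if a = i then 1 else 0) - 2 * (x $ a * x $ i)"
    by (simp add: Yfield_def)
  ultimately show ?thesis
    unfolding power2_eq_square by linarith
qed

lemma Yfield_nu_e_weight:
  fixes a i k :: "'n::finite"
  defines "w \<equiv> \<lambda>x::real^'n. Yfield a x $ i * nu_e x $ k"
  shows "continuous_on (- {0}) w" "w (- x) = - w x" "\<bar>w x\<bar> \<le> 3 * (norm x)\<^sup>2"
proof -
  show "continuous_on (- {0}) w"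
    unfolding w_def by (intro continuous_intros continuous_nu_e continuous_Yfield)
  show "w (- x) = - w x"
    by (simp add: w_def Yfield_def nu_e_def)
  show "\<bar>w x\<bar> \<le> 3 * (norm x)\<^sup>2"
    using mult_mono[OF Yfield_bound[of a x i] nu_e_component_le[of x k]] by (simp add: w_def abs_mult)
qed

context asymptotically_even_metric
begin

text \<open>Contracting \<open>kd\<close> with the unit normal twice gives 1, and the deviation is
  at most the sum of all \<open>\<bar>ginv g k l x - kd k l\<bar>\<close>, uniformly in direction.
  Nonvanishing is what permits cancelling the length, as division by 0 would return 0.\<close>

lemma conormal_len_nonzero: "eventually (\<lambda>x. conormal_len g x \<noteq> 0) at_infinity"
proof -
  let ?q = "\<lambda>x. \<Sum>k\<in>UNIV. \<Sum>l\<in>UNIV. ginv g k l x * nu_e x $ k * nu_e x $ l"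
  let ?d = "\<lambda>x. \<Sum>k\<in>UNIV. \<Sum>l\<in>UNIV. \<bar>ginv g k l x - kd k l\<bar>"
  have "((\<lambda>x. \<bar>ginv g k l x - kd k l\<bar>) \<longlongrightarrow> 0) at_infinity" for k l
    using even_near_tendsto[OF \<tau> ginv_near, of k l] by (intro tendsto_rabs_zero LIM_zero)
  then have "(?d \<longlongrightarrow> (\<Sum>k\<in>(UNIV::'n set). \<Sum>l\<in>(UNIV::'n set). 0)) at_infinity"
    by (intro tendsto_sum)
  then have "eventually (\<lambda>x. ?d x < 1) at_infinity"
    by (intro order_tendstoD(2)[of _ 0]) simp_all
  with eventually_norm_gt[of 0] show ?thesis
  proof eventually_elim
    case (elim x)
    have 1: "(\<Sum>k\<in>UNIV. \<Sum>l\<in>UNIV. kd k l * nu_e x $ k * nu_e x $ l) = 1"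
    proof -
      have "(\<Sum>k\<in>UNIV. \<Sum>l\<in>UNIV. kd k l * nu_e x $ k * nu_e x $ l) = (\<Sum>k\<in>UNIV. nu_e x $ k * nu_e x $ k)"
        by (simp add: mult.assoc)
      also have "\<dots> = nu_e x \<bullet> nu_e x"
        by (simp add: inner_vec_def)
      also have "\<dots> = 1"
        using elim by (simp add: nu_e_def power2_norm_eq_inner[symmetric] dot_square_norm)
      finally show ?thesis .
    qed
    have "\<bar>?q x - 1\<bar> = \<bar>\<Sum>k\<in>UNIV. \<Sum>l\<in>UNIV. (ginv g k l x - kd k l) * (nu_e x $ k * nu_e x $ l)\<bar>"
      unfolding 1[symmetric] by (simp add: algebra_simps sum_subtractf)
    also have "\<dots> \<le> (\<Sum>k\<in>UNIV. \<Sum>l\<in>UNIV. \<bar>(ginv g k l x - kd k l) * (nu_e x $ k * nu_e x $ l)\<bar>)"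
      by (intro order_trans[OF sum_abs] sum_mono sum_abs)
    also have "\<dots> \<le> ?d x"
    proof (intro sum_mono)
      fix k l
      have "\<bar>nu_e x $ k\<bar> * \<bar>nu_e x $ l\<bar> \<le> 1 * 1"
        by (intro mult_mono nu_e_component_le) auto
      then show "\<bar>(ginv g k l x - kd k l) * (nu_e x $ k * nu_e x $ l)\<bar> \<le> \<bar>ginv g k l x - kd k l\<bar>"
        unfolding abs_mult by (intro mult_left_le) auto
    qed
    finally have "?q x > 0"
      using elim by linarith
    then show ?case
      by (simp add: conormal_len_def)
  qed
qed

lemma einstein_integrand_eq:
  assumes "conormal_len g x \<noteq> 0"
  shows "(\<Sum>i\<in>UNIV. \<Sum>j\<in>UNIV. einstein g i j x * Yfield a x $ i * nu_g g x $ j) * area_g g x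
    = (\<Sum>k\<in>UNIV. \<Sum>i\<in>UNIV. einstein_flux i k x * Yfield a x $ i * nu_e x $ k)"
proof -
  let ?s = "sqrt (det (gmat g x))"
  have n: "nu_g g x $ j * area_g g x = ?s * (\<Sum>k\<in>UNIV. ginv g j k x * nu_e x $ k)" for j
    using assms by (simp add: nu_g_def area_g_def)
  have "(\<Sum>i\<in>UNIV. \<Sum>j\<in>UNIV. einstein g i j x * Yfield a x $ i * nu_g g x $ j) * area_g g x
      = (\<Sum>i\<in>UNIV. \<Sum>j\<in>UNIV. einstein g i j x * Yfield a x $ i * (nu_g g x $ j * area_g g x))"
    by (simp add: sum_distrib_right mult.assoc)
  also have "\<dots> = (\<Sum>i\<in>UNIV. \<Sum>j\<in>UNIV. \<Sum>k\<in>UNIV. ?s * (ginv g j k x * einstein g i j x) * Yfield a x $ i * nu_e x $ k)"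
    unfolding n by (simp add: sum_distrib_left mult_ac)
  also have "\<dots> = (\<Sum>i\<in>UNIV. \<Sum>k\<in>UNIV. \<Sum>j\<in>UNIV. ?s * (ginv g j k x * einstein g i j x) * Yfield a x $ i * nu_e x $ k)"
    by (intro sum.cong[OF refl] sum.swap)
  also have "\<dots> = (\<Sum>i\<in>UNIV. \<Sum>k\<in>UNIV. einstein_flux i k x * Yfield a x $ i * nu_e x $ k)"
    by (simp add: einstein_flux_def sum_distrib_left sum_distrib_right)
  also have "\<dots> = (\<Sum>k\<in>UNIV. \<Sum>i\<in>UNIV. einstein_flux i k x * Yfield a x $ i * nu_e x $ k)"
    by (rule sum.swap)
  finally show ?thesis .
qed

end

lemma eventually_at_infinity_sphere:
  assumes "eventually P (at_infinity :: 'a::real_normed_vector filter)"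
  shows "eventually (\<lambda>r. \<forall>x. norm x = r \<longrightarrow> P x) at_top"
proof -
  obtain b where "\<And>x. b \<le> norm x \<Longrightarrow> P x"
    using assms unfolding eventually_at_infinity by blast
  then show ?thesis
    by (intro eventually_mono[OF eventually_ge_at_top[of b]]) auto
qed

lemma parity_decay_continuous_sphere:
  assumes "parity_decay s p f"
  shows "eventually (\<lambda>r. continuous_on (sphere 0 r) f) at_top"
proof -
  obtain R where "continuous_on {x. R < norm x} f"
    using assms unfolding parity_decay_def by blast
  then show ?thesis
    by (intro eventually_mono[OF eventually_gt_at_top[of R]]) (auto elim!: continuous_on_subset)
qed

definition einstein_integrand :: "('n::finite \<Rightarrow> 'n \<Rightarrow> real^'n \<Rightarrow> real) \<Rightarrow> 'n \<Rightarrow> real^'n \<Rightarrow> real" where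
  "einstein_integrand g a x = (\<Sum>i\<in>UNIV. \<Sum>j\<in>UNIV. einstein g i j x * Yfield a x $ i * nu_g g x $ j) * area_g g x"

definition cs_integrand :: "('n::finite \<Rightarrow> 'n \<Rightarrow> real^'n \<Rightarrow> real) \<Rightarrow> 'n \<Rightarrow> real^'n \<Rightarrow> real" where
  "cs_integrand g a x = (\<Sum>i\<in>UNIV. \<Sum>j\<in>UNIV. x $ a * (pd (g i j) i x - pd (g i i) j x) * nu_e x $ j)
        - ((\<Sum>i\<in>UNIV. g i a x * nu_e x $ i) - (\<Sum>i\<in>UNIV. g i i x) * nu_e x $ a)"

context asymptotically_even_metric
begin

definition flux_remainder :: "'n \<Rightarrow> real^'n \<Rightarrow> real" where
  "flux_remainder a x = (\<Sum>k\<in>UNIV. \<Sum>i\<in>UNIV. (einstein_flux i k x - lin_einstein (hess x) i k) * (Yfield a x $ i * nu_e x $ k))"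

lemma continuous_on_sphere_weight:
  "r > 0 \<Longrightarrow> continuous_on (sphere 0 r) (\<lambda>x. Yfield a x $ i * nu_e x $ k)"
  by (rule continuous_on_subset[OF Yfield_nu_e_weight(1)]) auto

lemma flux_remainder_tendsto:
  assumes n: "2 * \<tau> + 2 = real CARD('n)"
  shows "((\<lambda>r. sphere_int r (flux_remainder a)) \<longlongrightarrow> 0) at_top"
proof -
  let ?T = "\<lambda>i k x. einstein_flux i k x - lin_einstein (hess x) i k"
  let ?w = "\<lambda>i k x. Yfield a x $ i * nu_e x $ k"
  have T: "parity_decay 1 (real CARD('n)) (?T i k)" for i k
    using einstein_flux_approx[of i k] n by simp
  have "((\<lambda>r. sphere_int r (\<lambda>x. ?T i k x * ?w i k x)) \<longlongrightarrow> 0) at_top" for i k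
    by (rule sphere_int_parity_tendsto[OF T Yfield_nu_e_weight])
  then have lim: "((\<lambda>r. \<Sum>k\<in>UNIV. \<Sum>i\<in>UNIV. sphere_int r (\<lambda>x. ?T i k x * ?w i k x)) \<longlongrightarrow> 0) at_top"
    by (intro tendsto_null_sum)
  have "eventually (\<lambda>r. \<forall>k i. continuous_on (sphere 0 r) (?T i k)) at_top"
    by (intro eventually_all_finite parity_decay_continuous_sphere[OF T])
  with eventually_gt_at_top[of 0]
  have "eventually (\<lambda>r. (\<Sum>k\<in>UNIV. \<Sum>i\<in>UNIV. sphere_int r (\<lambda>x. ?T i k x * ?w i k x)) = sphere_int r (flux_remainder a)) at_top"
  proof eventually_elim
    case (elim r)
    have c: "continuous_on (sphere 0 r) (\<lambda>x. ?T i k x * ?w i k x)" for i k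
      using elim by (intro continuous_on_mult continuous_on_sphere_weight) auto
    show ?case
      unfolding flux_remainder_def
      by (subst sphere_int_sum[OF elim(1)], intro continuous_on_sum c, subst sphere_int_sum[OF elim(1)], rule c, rule refl)
  qed
  from Lim_transform_eventually[OF lim this] show ?thesis .
qed

text \<open>The integrand of \<open>c_I\<close> is the linear flux plus the remainder; the linear
  part equals (n - 2) times the other integral exactly. Continuity on the sphere is collected in
  order to split the integrals.\<close>

lemma eventually_einstein_flux:
  "eventually (\<lambda>r. sphere_int r (einstein_integrand g a)
     = sphere_int r (flux_remainder a) + (real CARD('n) - 2) * sphere_int r (cs_integrand g a)) at_top"
proof -
  let ?T = "\<lambda>i k x. einstein_flux i k x - lin_einstein (hess x) i k"
  let ?w = "\<lambda>i k x. Yfield a x $ i * nu_e x $ k"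
  let ?L = "\<lambda>x. \<Sum>k\<in>UNIV. \<Sum>i\<in>UNIV. lin_einstein (hess x) i k * Yfield a x $ i * nu_e x $ k"
  have "eventually (\<lambda>r. \<forall>k i. continuous_on (sphere 0 r) (?T i k)) at_top"
    by (intro eventually_all_finite parity_decay_continuous_sphere[OF einstein_flux_approx])
  then show ?thesis
    using eventually_gt_at_top[of 0] eventually_gt_at_top[of R0]
      eventually_at_infinity_sphere[OF conormal_len_nonzero]
  proof eventually_elim
    case (elim r)
    let ?S = "sphere (0::real^'n) r"
    have U: "?S \<subseteq> {x. R0 < norm x}" using elim by auto
    have c0: "continuous_on ?S (g i j)" for i j
      using U by (intro continuous_at_imp_continuous_on ballI differentiable_imp_continuous_within d1) auto
    have c1: "continuous_on ?S (pd (g i j) k)" for i j k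
      using U by (intro continuous_at_imp_continuous_on ballI differentiable_imp_continuous_within d2) auto
    have c2': "continuous_on ?S (\<lambda>x. hess x i j k l)" for i j k l
      using continuous_on_subset[OF c2 U] .
    have cnu: "continuous_on ?S (\<lambda>x. nu_e x $ k)" for k
      using elim(2) by (intro continuous_on_subset[OF continuous_nu_e]) auto
    have cD: "continuous_on ?S (flux_remainder a)"
      unfolding flux_remainder_def
      using elim by (intro continuous_on_sum continuous_on_mult[OF _ continuous_on_sphere_weight]) auto
    have cL: "continuous_on ?S ?L"
      unfolding lin_einstein_def lin_ricci_def by (intro continuous_intros c2' cnu continuous_Yfield)
    have cCS: "continuous_on ?S (cs_integrand g a)"
      unfolding cs_integrand_def by (intro continuous_intros c0 c1 cnu)
    have "sphere_int r (einstein_integrand g a) = sphere_int r (\<lambda>x. flux_remainder a x + ?L x)"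
    proof (rule sphere_int_cong[OF elim(2)])
      fix x :: "real^'n" assume "norm x = r"
      then have "conormal_len g x \<noteq> 0" using elim by blast
      from einstein_integrand_eq[OF this] show "einstein_integrand g a x = flux_remainder a x + ?L x"
        unfolding einstein_integrand_def flux_remainder_def sum.distrib[symmetric]
        by (simp add: algebra_simps)
    qed
    also have "\<dots> = sphere_int r (flux_remainder a) + sphere_int r ?L"
      by (rule sphere_int_add[OF elim(2) cD cL])
    also have "sphere_int r ?L = (real CARD('n) - 2) * sphere_int r (cs_integrand g a)"
    proof -
      have "sphere_int r (\<lambda>x. ?L x - (real CARD('n) - 2) * cs_integrand g a x) = 0"
        unfolding cs_integrand_def
        by (rule sphere_int_lin_einstein[OF open_exterior[of R0] sym d1 d2 c2 elim(2) U]) auto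
      then show ?thesis
        using sphere_int_diff[OF elim(2) cL continuous_on_mult[OF continuous_on_const cCS, of "real CARD('n) - 2"]]
        by (simp add: sphere_int_cmult)
    qed
    finally show ?case .
  qed
qed

end

section \<open>From the stated decay conditions to asymptotic evenness, and the conclusion\<close>

lemma small_o_tendsto:
  assumes "small_o k p f" "length is \<le> k"
  shows "((\<lambda>x. norm x powr (real (length is) + p) * pds f is x) \<longlongrightarrow> 0) at_infinity"
proof (rule tendsto_rabs_zero_cancel)
  show "((\<lambda>x. \<bar>norm x powr (real (length is) + p) * pds f is x\<bar>) \<longlongrightarrow> 0) at_infinity"
    using assms unfolding small_o_def by (simp add: abs_mult)
qed

lemma Ck_2D:
  assumes "Ck 2 {x::real^'n. R < norm x} f" "R < norm x"
  shows "f differentiable (at x)" "pd f i differentiable (at x)"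
    "continuous_on {x. R < norm x} (pd (pd f i) j)"
proof -
  have "f differentiable_on {x. R < norm x}" "pd f i differentiable_on {x. R < norm x}"
    "continuous_on {x. R < norm x} (pd (pd f i) j)"
    using assms(1) by (simp_all add: numeral_2_eq_2)
  then show "f differentiable (at x)" "pd f i differentiable (at x)"
    "continuous_on {x. R < norm x} (pd (pd f i) j)"
    using assms(2) by (auto simp: differentiable_on_eq_differentiable_at[OF open_exterior])
qed

lemma differentiable_imp_continuous_exterior:
  "(\<And>x::real^'n. R < norm x \<Longrightarrow> f differentiable (at x)) \<Longrightarrow> continuous_on {x. R < norm x} f"
  by (intro continuous_at_imp_continuous_on ballI differentiable_imp_continuous_within) auto

text \<open>Reflection contributes a minus sign, so differentiating the odd part of \<open>f\<close>
  gives the even part of the derivative: precisely the amount by which \<open>pd f i\<close> fails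
  to be odd.\<close>

lemma pd_oddpart:
  assumes "f differentiable (at x)" "f differentiable (at (- x))"
  shows "pd (oddpart f) i x = (pd f i x + pd f i (- x)) / 2"
proof -
  have "oddpart f = (\<lambda>x. 1/2 * (f x - f (- x)))"
    by (simp add: oddpart_def fun_eq_iff)
  then show ?thesis
    by (simp add: pd_mult pd_diff assms pd_uminus_arg differentiable_diff pd_cmult[of _ x "1/2", simplified])
qed

lemma pd_pd_oddpart:
  assumes f: "\<And>x. R < norm x \<Longrightarrow> f differentiable (at x)" "\<And>x. R < norm x \<Longrightarrow> pd f i differentiable (at x)"
    and x: "R < norm x"
  shows "pd (pd (oddpart f) i) j x = (pd (pd f i) j x - pd (pd f i) j (- x)) / 2"
proof -
  have "pd (pd (oddpart f) i) j x = pd (\<lambda>x. 1/2 * (pd f i x + pd f i (- x))) j x"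
    by (rule pd_cong[OF open_exterior[of R]]) (use x f in \<open>auto simp: pd_oddpart\<close>)
  also have "\<dots> = 1/2 * (pd (pd f i) j x - pd (pd f i) j (- x))"
    using x f(2) pd_uminus_arg[of "pd f i" x] by (subst pd_cmult) (auto simp: pd_add)
  finally show ?thesis by simp
qed

lemma asymptotically_even_metric_intro:
  fixes g :: "'n::finite \<Rightarrow> 'n \<Rightarrow> real^'n \<Rightarrow> real"
  assumes \<tau>: "0 \<le> \<tau>"
    and riem: "riemannian_near_infinity g"
    and even: "\<And>i j. small_o 2 \<tau> (\<lambda>x. g i j x - kd i j)"
    and odd: "\<And>i j. small_o 2 (\<tau> + 1) (oddpart (g i j))"
  obtains R0 where "asymptotically_even_metric g \<tau> R0"
proof -
  obtain Rs where Rs: "\<And>x i j. Rs < norm x \<Longrightarrow> g i j x = g j i x"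
    using riem unfolding riemannian_near_infinity_def by blast
  have "\<exists>R. Ck 2 {x. R < norm x} (\<lambda>x. g i j x - kd i j)" for i j
    using even unfolding small_o_def by blast
  then obtain R where R: "\<And>i j. Ck 2 {x. R i j < norm x} (\<lambda>x. g i j x - kd i j)"
    by metis
  \<comment> \<open>One radius for all coefficients, a maximum over finitely many index
    pairs.\<close>
  define R0 where "R0 = max Rs (Max (range (\<lambda>(i, j). R i j)))"
  have R0: "Rs \<le> R0" "R i j \<le> R0" for i j
  proof -
    have "R i j \<le> Max (range (\<lambda>(i, j). R i j))"
      by (rule Max_ge) (auto intro!: image_eqI[of _ _ "(i, j)"])
    then show "Rs \<le> R0" "R i j \<le> R0" by (auto simp: R0_def)
  qed
  have D: "g i j differentiable (at x)" "pd (g i j) k differentiable (at x)" if "R0 < norm x" for i j k x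
  proof -
    have "R i j < norm x" using that R0(2)[of i j] by linarith
    note C = Ck_2D[OF R this]
    have "(\<lambda>x. (g i j x - kd i j) + kd i j) differentiable (at x)"
      by (rule differentiable_add[OF C(1) differentiable_const])
    then show "g i j differentiable (at x)" by simp
    show "pd (g i j) k differentiable (at x)"
      using C(2)[of k] by (simp only: pd_diff_const)
  qed
  have C2: "continuous_on {x. R0 < norm x} (pd (pd (g i j) k) l)" for i j k l
  proof -
    \<comment> \<open>\<open>Ck_2D\<close> is stated at a point outside the ball of radius
      \<open>R i j\<close>; the maximum with 0 makes the prescribed norm admissible when that radius
      is very negative.\<close>
    obtain x :: "real^'n" where "norm x = max 0 (R i j + 1)"
      using vector_choose_size[of "max 0 (R i j + 1)"] by auto
    then have "R i j < norm x" by simp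
    then have "continuous_on {x. R i j < norm x} (pd (pd (g i j) k) l)"
      using Ck_2D(3)[OF R, of i j x k l] by (simp only: pd_diff_const)
    then show ?thesis
      by (rule continuous_on_subset) (use R0(2)[of i j] in auto)
  qed
  note cont = differentiable_imp_continuous_exterior
  \<comment> \<open>The differences in \<open>parity_decay\<close> are twice the odd part or its
    derivatives, so the Regge-Teitelboim condition enters with a factor 2.\<close>
  have two: "(f \<longlongrightarrow> 0) at_infinity" if "((\<lambda>x. norm x powr q * h x) \<longlongrightarrow> 0) at_infinity"
    "\<And>x. R0 < norm x \<Longrightarrow> f x = 2 * (norm x powr q * h x)" for f h :: "real^'n \<Rightarrow> real" and q
  proof (rule Lim_transform_eventually)
    show "((\<lambda>x. 2 * (norm x powr q * h x)) \<longlongrightarrow> 0) at_infinity"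
      using tendsto_mult_right_zero[OF that(1)] .
    show "\<forall>\<^sub>F x in at_infinity. 2 * (norm x powr q * h x) = f x"
      by (rule eventually_mono[OF eventually_norm_gt[of R0]]) (simp add: that(2))
  qed
  have "asymptotically_even_metric g \<tau> R0"
  proof
    show "0 \<le> \<tau>" by (rule \<tau>)
    show "g i j x = g j i x" if "R0 < norm x" for i j x
      using Rs[of x] that R0(1) by auto
    show "even_near \<tau> (kd i j) (g i j)" for i j
      unfolding even_near_def parity_decay_def
    proof (intro conjI exI)
      show "continuous_on {x. R0 < norm x} (\<lambda>x. g i j x - kd i j)"
        by (intro continuous_intros cont D(1))
      show "((\<lambda>x. norm x powr \<tau> * (g i j x - kd i j)) \<longlongrightarrow> 0) at_infinity"
        using small_o_tendsto[OF even, of "[]" i j] by simp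
      show "((\<lambda>x. norm x powr (\<tau> + 1) * (g i j x - kd i j - 1 * (g i j (- x) - kd i j))) \<longlongrightarrow> 0) at_infinity"
        by (rule two[of "\<tau> + 1" "oddpart (g i j)"])
           (use small_o_tendsto[OF odd, of "[]" i j] in \<open>simp_all add: oddpart_def algebra_simps\<close>)
    qed
    show "parity_decay (-1) (\<tau> + 1) (pd (g i j) k)" for i j k
      unfolding parity_decay_def
    proof (intro conjI exI)
      show "continuous_on {x. R0 < norm x} (pd (g i j) k)"
        by (intro cont D(2))
      show "((\<lambda>x. norm x powr (\<tau> + 1) * pd (g i j) k x) \<longlongrightarrow> 0) at_infinity"
        using small_o_tendsto[OF even, of "[k]" i j] by (simp add: pd_diff_const add.commute)
      show "((\<lambda>x. norm x powr (\<tau> + 1 + 1) * (pd (g i j) k x - - 1 * pd (g i j) k (- x))) \<longlongrightarrow> 0) at_infinity"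
        by (rule two[of "\<tau> + 1 + 1" "pd (oddpart (g i j)) k"])
           (use small_o_tendsto[OF odd, of "[k]" i j] in \<open>simp_all add: pd_oddpart D(1) algebra_simps\<close>)
    qed
    show "parity_decay 1 (\<tau> + 2) (pd (pd (g i j) k) l)" for i j k l
      unfolding parity_decay_def
    proof (intro conjI exI)
      show "continuous_on {x. R0 < norm x} (pd (pd (g i j) k) l)"
        by (rule C2)
      \<comment> \<open>The list is \<open>[l, k]\<close> because \<open>pds\<close> applies the
        head of the list last.\<close>
      show "((\<lambda>x. norm x powr (\<tau> + 2) * pd (pd (g i j) k) l x) \<longlongrightarrow> 0) at_infinity"
        using small_o_tendsto[OF even, of "[l, k]" i j] by (simp add: pd_diff_const add.commute)
      show "((\<lambda>x. norm x powr (\<tau> + 2 + 1) * (pd (pd (g i j) k) l x - 1 * pd (pd (g i j) k) l (- x))) \<longlongrightarrow> 0) at_infinity"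
        by (rule two[of "\<tau> + 2 + 1" "pd (pd (oddpart (g i j)) k) l"])
           (use small_o_tendsto[OF odd, of "[l, k]" i j] in \<open>simp_all add: pd_pd_oddpart[OF D] algebra_simps\<close>)
    qed
  qed (rule D C2; assumption?)+
  then show ?thesis by (rule that)
qed

theorem theorem3p2:
  fixes g :: "'n::finite \<Rightarrow> 'n \<Rightarrow> real^'n \<Rightarrow> real" and m :: real
  assumes "CARD('n) \<ge> 3"
    and "riemannian_near_infinity g"
    and "\<forall>i j. small_o 2 ((real CARD('n) - 2) / 2) (\<lambda>x. g i j x - (if i = j then 1 else 0))"
    and "\<forall>i j. small_o 2 (real CARD('n) / 2) (oddpart (g i j))"
    and "(adm_mass_r g \<longlongrightarrow> m) at_top"
    and "m \<noteq> 0"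
  shows "((\<lambda>r. c_CS g m r - c_I g m r) \<longlongrightarrow> 0) at_top"
proof -
  let ?\<tau> = "(real CARD('n) - 2) / 2" and ?n = "real CARD('n)"
  have n: "?n \<ge> 3" using assms(1) by simp
  \<comment> \<open>One power beyond the decay of the metric is exactly the Regge-Teitelboim
    exponent.\<close>
  have \<tau>: "?\<tau> + 1 = ?n / 2" by (simp add: field_simps)
  obtain R0 where "asymptotically_even_metric g ?\<tau> R0"
  proof (rule asymptotically_even_metric_intro)
    show "small_o 2 ?\<tau> (\<lambda>x. g i j x - kd i j)" for i j
      using assms(3) by (simp add: kd_def)
    show "small_o 2 (?\<tau> + 1) (oddpart (g i j))" for i j
      using assms(4) by (simp only: \<tau>)
  qed (use n assms(2) in simp_all)
  then interpret asymptotically_even_metric g ?\<tau> R0 .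
  let ?K = "1 / (2 * (?n - 1) * (?n - 2) * omega TYPE('n) * m)"
  show ?thesis
  proof (rule vec_tendstoI)
    fix a
    have "((\<lambda>r. - ?K * sphere_int r (flux_remainder a)) \<longlongrightarrow> - ?K * 0) at_top"
      by (intro tendsto_mult_left flux_remainder_tendsto) (simp add: field_simps)
    moreover have "eventually (\<lambda>r. - ?K * sphere_int r (flux_remainder a) = (c_CS g m r - c_I g m r) $ a) at_top"
      using eventually_einstein_flux[of a]
    proof eventually_elim
      case (elim r)
      have "(c_CS g m r - c_I g m r) $ a
        = 1 / (2 * (?n - 1) * omega TYPE('n) * m) * sphere_int r (cs_integrand g a) - ?K * sphere_int r (einstein_integrand g a)"
        by (simp add: c_CS_def c_I_def cs_integrand_def[abs_def] einstein_integrand_def[abs_def])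
      \<comment> \<open>\<open>n - 2\<close> is nonzero, so it can be absorbed: both centres then
        share the prefactor \<open>?K\<close>, and their difference is \<open>- ?K\<close> times the
        remainder flux.\<close>
      also have "1 / (2 * (?n - 1) * omega TYPE('n) * m) = ?K * (?n - 2)"
        using n by simp
      finally show ?case
        unfolding elim by (simp only: algebra_simps)
    qed
    ultimately show "((\<lambda>r. (c_CS g m r - c_I g m r) $ a) \<longlongrightarrow> 0 $ a) at_top"
      by (simp add: Lim_transform_eventually)
  qed
qed

end
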